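(* Suppose that the Fourier coefficients of $f\in L^1([-\pi,\pi])$ are real. Then, for every $n$, the following properties hold. 1. The eigenvalues of $H_n(f)$ lie in $[-M_{|f|},-d]\cup[d,M_{|f|}]$, where $d$ is the distance of the complex zero from the convex hull of the essential range $\mathcal{ER}(f)$ and $M_{|f|}=\operatorname{ess\,sup}_{[-\pi,\pi]}|f|$. 2. Assume that $|f|$ is not a.e. constant. Then, the eigenvalues of $H_n(f)$ lie in $(-M_{|f|},-d]\cup[d,M_{|f|})$, where $d$ and $M_{|f|}$ are as in item 1. 3. Assume that $f(\theta)=\sum_{k=-r}^{r}f_ke^{\mathrm{i}k\theta}$ is a trigonometric polynomial of degree $r$, and let $m_{|f|}=\min_{[-\pi,\pi]}|f|$ and $M_{|f|}=\max_{[-\pi,\pi]}|f|$. Then, the eigenvalues of $H_n(f)$ lie in $[-M_{|f|},-m_{|f|}]\cup[m_{|f|},M_{|f|}]$ except for at most $2r$ small outliers lying in $(-m_{|f|},m_{|f|})$.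
   Context: For $f\in L^1([-\pi,\pi])$ (complex-valued) the Fourier coefficients are $f_k=\frac1{2\pi}\int_{-\pi}^{\pi}f(x)e^{-\mathrm{i}kx}\,dx$, $k\in\mathbb Z$; $T_n(f)=[f_{i-j}]_{i,j=1}^n$ is the $n\times n$ Toeplitz matrix generated by $f$; $Y_n$ is the $n\times n$ exchange matrix, with entries $1$ on the main anti-diagonal ($i+j=n+1$) and $0$ elsewhere; $H_n(f)=Y_nT_n(f)$. When the Fourier coefficients are real, $H_n(f)$ is real symmetric. Eigenvalues are counted with multiplicity. The essential range of a measurable $f$ on $[-\pi,\pi]$ is $\mathcal{ER}(f)=\{z\in\mathbb C:\ \mu\{|f-z|<\epsilon\}>0\text{ for all }\epsilon>0\}$, with $\mu$ the Lebesgue measure; for a real-valued function $g$, $\operatorname{ess\,sup}g=\sup\mathcal{ER}(g)$ (possibly $+\infty$). *)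

theory Defs
  imports
    "HOL-Analysis.Analysis"
    "Jordan_Normal_Form.Char_Poly"
begin

abbreviation circle_measure :: "real measure" where
  "circle_measure \<equiv> lebesgue_on {-pi..pi}"

definition fourier_coeff :: "(real \<Rightarrow> complex) \<Rightarrow> int \<Rightarrow> complex" where
  "fourier_coeff f k =
     1 / (2 * of_real pi) * (\<integral>x. f x * exp (- (\<i> * of_int k * of_real x)) \<partial>circle_measure)"

(* Row and column indices of matrices start at 0 here.  The Toeplitz entries depend only on the
   difference of the indices; the anti-diagonal i + j = n + 1 of the 1-based convention
   becomes i + j + 1 = n. *)

definition toeplitz :: "nat \<Rightarrow> (real \<Rightarrow> complex) \<Rightarrow> complex mat" where
  "toeplitz n f = Matrix.mat n n (\<lambda>(i, j). fourier_coeff f (int i - int j))"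

definition exchange_mat :: "nat \<Rightarrow> complex mat" where
  "exchange_mat n = Matrix.mat n n (\<lambda>(i, j). if i + j + 1 = n then 1 else 0)"

definition flipped_toeplitz :: "nat \<Rightarrow> (real \<Rightarrow> complex) \<Rightarrow> complex mat" where
  "flipped_toeplitz n f = exchange_mat n * toeplitz n f"

definition eigenvalue_mset :: "complex mat \<Rightarrow> complex multiset" where
  "eigenvalue_mset A = proots (char_poly A)"

(* For real-valued g this is taken inside the reals, which loses nothing: a non-real complex
   number has a neighbourhood that g never enters. *)
definition essential_range :: "(real \<Rightarrow> 'a::real_normed_vector) \<Rightarrow> 'a set" where
  "essential_range f =
     {z. \<forall>\<epsilon>>0. emeasure circle_measure {x \<in> {-pi..pi}. norm (f x - z) < \<epsilon>} > 0}"

(* Extended-real-valued, since the supremum may be infinite. *)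
definition ess_sup :: "(real \<Rightarrow> real) \<Rightarrow> ereal" where
  "ess_sup g = (SUP z \<in> essential_range g. ereal z)"

end

theory Submission
  imports Defs "Jordan_Normal_Form.Schur_Decomposition"
begin

text \<open>Write \<open>p\<^sub>x(\<theta>) = \<Sum>\<^sub>j x\<^sub>j e\<^sup>i\<^sup>j\<^sup>\<theta>\<close>. The sesquilinear form of the Toeplitz matrix is
  \<open>y\<^sup>* T\<^sub>n(f) x = (1/2\<pi>) \<integral> f p\<^sub>y\<^sup>* p\<^sub>x\<close>, and \<open>H\<^sub>n(f) x = \<lambda> x\<close> means \<open>T\<^sub>n(f) x = \<lambda> Y\<^sub>n x\<close>.
  Taking \<open>y = Y\<^sub>n x\<close> bounds \<open>|\<lambda>|\<close> from above by a mean of \<open>|f|\<close> against a weight that vanishes at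
  finitely many points only; this is strict unless \<open>|f|\<close> is constant. Taking \<open>y = x\<close> and projecting onto
  the point of the closed convex hull of the essential range nearest to zero bounds
  \<open>|\<lambda>|\<close> from below. For a trigonometric polynomial of degree \<open>r\<close> and \<open>x\<close> vanishing in
  its first and last \<open>r\<close> entries, \<open>f p\<^sub>x\<close> is the polynomial of \<open>T\<^sub>n(f) x\<close>, so that
  \<open>\<parallel>H\<^sub>n(f) x\<parallel> \<ge> m \<parallel>x\<parallel>\<close>; more than \<open>2 r\<close> orthogonal eigenvectors with \<open>|\<lambda>| < m\<close> would
  span a space containing a nonzero such \<open>x\<close>, which is impossible.\<close>

subsection \<open>Hermitian matrices\<close>

text \<open>Gaussian elimination, by induction on the equations: an equation that is identically
  zero is dropped, and otherwise a pivot removes one equation together with one unknown. It serves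
  two dimension counts: orthogonalizing the Schur flag, and combining eigenvectors so that
  prescribed entries vanish.\<close>

lemma underdetermined_homogeneous_system:
  fixes G :: "'i \<Rightarrow> 'j \<Rightarrow> 'a::field"
  assumes "finite J" "finite S" "card J < card S"
  shows "\<exists>c. (\<exists>s\<in>S. c s \<noteq> 0) \<and> (\<forall>j\<in>J. (\<Sum>s\<in>S. G j s * c s) = 0)"
  using assms
proof (induction J arbitrary: S G rule: finite_induct)
  case empty
  then have "S \<noteq> {}" by auto
  then show ?case by (intro exI[of _ "\<lambda>_. 1"]) auto
next
  case (insert k J)
  show ?case
  proof (cases "\<forall>s\<in>S. G k s = 0")
    case True
    have "card J < card S" using insert by auto
    from insert.IH[OF insert.prems(1) this, of G] True show ?thesis by auto
  next
    case False
    then obtain t where t: "t \<in> S" "G k t \<noteq> 0" by blast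
    \<comment> \<open>Row reduction with pivot \<open>G k t\<close>: column \<open>t\<close> of
      \<open>G'\<close> is zero, so this unknown leaves the remaining equations.\<close>
    define G' where "G' = (\<lambda>i s. G i s - G i t * G k s / G k t)"
    have "card J < card (S - {t})" using insert t by auto
    from insert.IH[OF _ this, of G'] insert.prems(1)
    obtain c where c: "\<exists>s\<in>S - {t}. c s \<noteq> 0" "\<forall>j\<in>J. (\<Sum>s\<in>S-{t}. G' j s * c s) = 0"
      by auto
    \<comment> \<open>The value of the unknown \<open>t\<close> that solves equation
      \<open>k\<close> once the other unknowns are given.\<close>
    define a where "a = - (\<Sum>s\<in>S-{t}. G k s * c s) / G k t"
    define c' where "c' = c(t := a)"
    have split: "(\<Sum>s\<in>S. G j s * c' s) = G j t * a + (\<Sum>s\<in>S-{t}. G j s * c s)" for j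
    proof -
      have "(\<Sum>s\<in>S. G j s * c' s) = G j t * c' t + (\<Sum>s\<in>S-{t}. G j s * c' s)"
        using t insert.prems(1) by (simp add: sum.remove)
      moreover have "(\<Sum>s\<in>S-{t}. G j s * c' s) = (\<Sum>s\<in>S-{t}. G j s * c s)"
        by (rule sum.cong) (auto simp: c'_def)
      ultimately show ?thesis by (simp add: c'_def)
    qed
    have "(\<Sum>s\<in>S. G j s * c' s) = 0" if "j \<in> insert k J" for j
    proof (cases "j = k")
      case True
      then show ?thesis using t by (simp add: split a_def)
    next
      case False
      then have "0 = (\<Sum>s\<in>S-{t}. G' j s * c s)" using c that by auto
      also have "\<dots> = (\<Sum>s\<in>S-{t}. G j s * c s) - (\<Sum>s\<in>S-{t}. G j t / G k t * (G k s * c s))"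
        unfolding G'_def sum_subtractf[symmetric] by (rule sum.cong) (auto simp: field_simps)
      also have "\<dots> = (\<Sum>s\<in>S. G j s * c' s)"
        unfolding split sum_distrib_left[symmetric] a_def by simp
      finally show ?thesis by simp
    qed
    moreover have "\<exists>s\<in>S. c' s \<noteq> 0" using c(1) by (auto simp: c'_def)
    ultimately show ?thesis by blast
  qed
qed

lemma inner_self_sum_zero:
  fixes v :: "nat \<Rightarrow> complex"
  assumes "(\<Sum>i<n. cnj (v i) * v i) = 0" "i < n"
  shows "v i = 0"
proof -
  have "of_real (\<Sum>i<n. (cmod (v i))\<^sup>2) = (\<Sum>i<n. cnj (v i) * v i)"
    unfolding of_real_sum
    by (intro sum.cong refl) (metis complex_norm_square mult.commute)
  then have "(\<Sum>i<n. (cmod (v i))\<^sup>2) = 0"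
    using assms(1) by (metis of_real_eq_0_iff)
  then show ?thesis using assms(2) by (subst (asm) sum_nonneg_eq_0_iff) auto
qed

lemma hermitian_form_commute:
  fixes A :: "nat \<Rightarrow> nat \<Rightarrow> complex"
  assumes herm: "\<And>i j. i < n \<Longrightarrow> j < n \<Longrightarrow> A j i = cnj (A i j)"
  shows "(\<Sum>i<n. cnj (\<Sum>j<n. A i j * x j) * y i) = (\<Sum>i<n. cnj (x i) * (\<Sum>j<n. A i j * y j))"
proof -
  have "(\<Sum>i<n. cnj (\<Sum>j<n. A i j * x j) * y i) = (\<Sum>i<n. \<Sum>j<n. cnj (x j) * (A j i * y i))"
    unfolding sum_distrib_right cnj_sum
  proof (intro sum.cong refl)
    fix i j assume "i \<in> {..<n}" "j \<in> {..<n}"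
    then show "cnj (A i j * x j) * y i = cnj (x j) * (A j i * y i)"
      using herm[of i j] by (metis complex_cnj_mult lessThan_iff mult.assoc mult.commute)
  qed
  also have "\<dots> = (\<Sum>j<n. \<Sum>i<n. cnj (x j) * (A j i * y i))"
    by (rule sum.swap)
  finally show ?thesis by (simp add: sum_distrib_left)
qed

lemma hermitian_eigenvalue_real:
  fixes A :: "nat \<Rightarrow> nat \<Rightarrow> complex"
  assumes herm: "\<And>i j. i < n \<Longrightarrow> j < n \<Longrightarrow> A j i = cnj (A i j)"
    and ev: "\<And>i. i < n \<Longrightarrow> (\<Sum>j<n. A i j * v j) = z * v i"
    and nz: "\<exists>i<n. v i \<noteq> 0"
  shows "z \<in> \<real>"
proof -
  have "cnj z * (\<Sum>i<n. cnj (v i) * v i) = (\<Sum>i<n. cnj (\<Sum>j<n. A i j * v j) * v i)"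
    by (simp add: ev sum_distrib_left mult.assoc del: cnj_sum)
  also have "\<dots> = (\<Sum>i<n. cnj (v i) * (\<Sum>j<n. A i j * v j))"
    by (rule hermitian_form_commute) (rule herm)
  also have "\<dots> = z * (\<Sum>i<n. cnj (v i) * v i)"
    unfolding sum_distrib_left[of z] by (intro sum.cong refl) (simp add: ev)
  finally have "cnj z * (\<Sum>i<n. cnj (v i) * v i) = z * (\<Sum>i<n. cnj (v i) * v i)" .
  moreover have "(\<Sum>i<n. cnj (v i) * v i) \<noteq> 0"
    using nz inner_self_sum_zero by blast
  ultimately have "cnj z = z" by (simp only: mult_cancel_right) simp
  then show ?thesis by (simp add: Reals_cnj_iff)
qed

text \<open>The Schur flag spanned by the columns of \<open>P\<close> is invariant; the part of its
  \<open>k\<close>-th step orthogonal to the previous ones is again invariant because the matrix is Hermitian.\<close>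
lemma hermitian_orthogonal_eigenvectors:
  fixes A :: "nat \<Rightarrow> nat \<Rightarrow> complex"
  assumes herm: "\<And>i j. i < n \<Longrightarrow> j < n \<Longrightarrow> A j i = cnj (A i j)"
  obtains es u where
    "char_poly (Matrix.mat n n (\<lambda>(i, j). A i j)) = (\<Prod>e\<leftarrow>es. [:- e, 1:])" "length es = n"
    "\<And>k i. k < n \<Longrightarrow> i < n \<Longrightarrow> (\<Sum>j<n. A i j * u k j) = es ! k * u k i"
    "\<And>k. k < n \<Longrightarrow> \<exists>i<n. u k i \<noteq> (0::complex)"
    "\<And>k l. k < n \<Longrightarrow> l < n \<Longrightarrow> k \<noteq> l \<Longrightarrow> (\<Sum>i<n. cnj (u k i) * u l i) = 0"
proof -
  define M where "M = Matrix.mat n n (\<lambda>(i, j). A i j)"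
  have M: "M \<in> carrier_mat n n" by (simp add: M_def)
  from char_poly_factorized[OF M] obtain es where
    es: "char_poly M = (\<Prod>e\<leftarrow>es. [:- e, 1:])" "length es = n" by blast
  obtain B P Q where sch: "schur_decomposition M es = (B, P, Q)"
    by (cases "schur_decomposition M es") auto
  from schur_decomposition[OF M es(1) sch]
  have sim: "similar_mat_wit M B P Q" and ut: "upper_triangular B" and dB: "diag_mat B = es"
    by auto
  from similar_mat_witD2[OF M sim] have B: "B \<in> carrier_mat n n" and P: "P \<in> carrier_mat n n"
    and Q: "Q \<in> carrier_mat n n" and QP: "Q * P = 1\<^sub>m n" and MPBQ: "M = P * B * Q" by auto
  have MP: "M * P = P * B"
  proof -
    have "M * P = P * B * (Q * P)" unfolding MPBQ using P B Q by (simp add: assoc_mult_mat[of _ n n _ n _ n])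
    then show ?thesis using P B by (simp add: QP)
  qed
  define p where "p = (\<lambda>k i. P $$ (i, k))"
  define b where "b = (\<lambda>i k. B $$ (i, k))"
  define q where "q = (\<lambda>i k. Q $$ (i, k))"
  \<comment> \<open>This is \<open>M * P = P * B\<close> read column by column; the sum stops at
    \<open>k\<close> because \<open>B\<close> is upper triangular.\<close>
  have Ap: "(\<Sum>j<n. A i j * p k j) = (\<Sum>l\<le>k. b l k * p l i)" if "i < n" "k < n" for i k
  proof -
    have "(\<Sum>j<n. A i j * p k j) = (M * P) $$ (i, k)"
      using that P by (simp add: M_def p_def scalar_prod_def lessThan_atLeast0)
    also have "\<dots> = (\<Sum>l<n. b l k * p l i)"
      unfolding MP using that P B by (simp add: b_def p_def scalar_prod_def lessThan_atLeast0 mult.commute)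
    also have "\<dots> = (\<Sum>l\<le>k. b l k * p l i)"
      using that ut B by (intro sum.mono_neutral_right) (auto simp: b_def upper_triangular_def)
    finally show ?thesis .
  qed
  have bd: "b k k = es ! k" if "k < n" for k
    using that B dB by (auto simp: b_def diag_mat_def)
  have qp: "(\<Sum>i<n. q l i * p k i) = (if l = k then 1 else 0)" if "l < n" "k < n" for l k
  proof -
    have "(\<Sum>i<n. q l i * p k i) = (Q * P) $$ (l, k)"
      using that P Q by (simp add: q_def p_def scalar_prod_def lessThan_atLeast0)
    then show ?thesis using that by (simp add: QP)
  qed
  \<comment> \<open>For each \<open>k\<close> there are \<open>k\<close> orthogonality conditions on
    \<open>k + 1\<close> coefficients, so a nonzero solution exists. This replaces Gram-Schmidt; the
    resulting \<open>u k\<close> are not normalized.\<close>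
  have "\<forall>k. \<exists>c. (\<exists>j\<in>{..k}. c j \<noteq> 0) \<and>
      (\<forall>l\<in>{..<k}. (\<Sum>j\<in>{..k}. (\<Sum>i<n. cnj (p l i) * p j i) * c j) = 0)"
    by (intro allI underdetermined_homogeneous_system) auto
  from choice[OF this] obtain c where cc: "\<forall>k. (\<exists>j\<in>{..k}. c k j \<noteq> 0) \<and>
      (\<forall>l\<in>{..<k}. (\<Sum>j\<in>{..k}. (\<Sum>i<n. cnj (p l i) * p j i) * c k j) = 0)" ..
  have c: "\<exists>j\<le>k. c k j \<noteq> 0"
    "l < k \<Longrightarrow> (\<Sum>j\<le>k. (\<Sum>i<n. cnj (p l i) * p j i) * c k j) = 0" for k l
    using cc[rule_format, of k] by (auto simp only: atMost_iff lessThan_iff)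
  define u where "u = (\<lambda>k i. \<Sum>j\<le>k. c k j * p j i)"
  have pu: "(\<Sum>i<n. cnj (p l i) * u k i) = 0" if "l < k" for l k
  proof -
    have "(\<Sum>i<n. cnj (p l i) * u k i) = (\<Sum>i<n. \<Sum>j\<le>k. cnj (p l i) * p j i * c k j)"
      by (simp add: u_def sum_distrib_left mult_ac)
    also have "\<dots> = (\<Sum>j\<le>k. (\<Sum>i<n. cnj (p l i) * p j i) * c k j)"
      by (subst sum.swap) (simp add: sum_distrib_right)
    finally show ?thesis using c(2)[OF that] by simp
  qed
  have span_orth: "(\<Sum>i<n. cnj (\<Sum>j\<in>J. a j * p j i) * u k i) = 0" if "\<And>j. j \<in> J \<Longrightarrow> j < k" for a J k
  proof -
    have "(\<Sum>i<n. cnj (\<Sum>j\<in>J. a j * p j i) * u k i) = (\<Sum>i<n. \<Sum>j\<in>J. cnj (a j) * (cnj (p j i) * u k i))"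
      by (simp add: sum_distrib_right mult.assoc)
    also have "\<dots> = (\<Sum>j\<in>J. cnj (a j) * (\<Sum>i<n. cnj (p j i) * u k i))"
      by (subst sum.swap) (simp add: sum_distrib_left)
    also have "\<dots> = 0" using that pu by simp
    finally show ?thesis .
  qed
  have orth_less: "(\<Sum>i<n. cnj (u l i) * u k i) = 0" if "l < k" for k l
    using span_orth[of "{..l}" k "c l"] that by (simp add: u_def)
  have orth: "(\<Sum>i<n. cnj (u k i) * u l i) = 0" if "k \<noteq> l" for k l
  proof (cases "k < l")
    case True then show ?thesis by (rule orth_less)
  next
    case False
    then have "l < k" using that by simp
    from arg_cong[OF orth_less[OF this], of cnj] show ?thesis by (simp add: mult.commute)
  qed
  have nz: "\<exists>i<n. u k i \<noteq> 0" if k: "k < n" for k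
  proof (rule ccontr)
    assume "\<not> ?thesis"
    then have u0: "u k i = 0" if "i < n" for i using that by auto
    obtain l where l: "l \<le> k" "c k l \<noteq> 0" using c(1) by auto
    \<comment> \<open>The rows of \<open>Q\<close> are dual to the columns of \<open>P\<close>, so
      pairing with row \<open>l\<close> reads off the coefficient \<open>c k l\<close>, which was
      chosen nonzero.\<close>
    have "0 = (\<Sum>i<n. q l i * u k i)" using u0 by simp
    also have "\<dots> = (\<Sum>i<n. \<Sum>j\<le>k. c k j * (q l i * p j i))"
      by (simp add: u_def sum_distrib_left mult_ac)
    also have "\<dots> = (\<Sum>j\<le>k. c k j * (\<Sum>i<n. q l i * p j i))"
      by (subst sum.swap) (simp add: sum_distrib_left)
    also have "\<dots> = (\<Sum>j\<le>k. c k j * (if l = j then 1 else 0))"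
      using l k by (intro sum.cong refl) (simp add: qp)
    also have "\<dots> = c k l" using l by (simp add: if_distrib cong: if_cong)
    finally show False using l by simp
  qed
  have ev: "(\<Sum>j<n. A i j * u k j) = es ! k * u k i" if k: "k < n" and "i < n" for k i
  proof -
    \<comment> \<open>The residual of the eigenvector equation. It lies in the span of the
      \<open>p l\<close> with \<open>l < k\<close> and is orthogonal to that same span, hence it
      vanishes.\<close>
    define w where "w = (\<lambda>i. (\<Sum>j<n. A i j * u k j) - es ! k * u k i)"
    have Au: "(\<Sum>j<n. A i j * u k j) = (\<Sum>j\<le>k. c k j * (\<Sum>l\<le>j. b l j * p l i))" if "i < n" for i
    proof -
      have "(\<Sum>j<n. A i j * u k j) = (\<Sum>j<n. \<Sum>m\<le>k. c k m * (A i j * p m j))"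
        by (simp add: u_def sum_distrib_left mult_ac)
      also have "\<dots> = (\<Sum>m\<le>k. c k m * (\<Sum>j<n. A i j * p m j))"
        by (subst sum.swap) (simp add: sum_distrib_left)
      finally show ?thesis using Ap that k by simp
    qed
    define a where "a = (\<lambda>l. (\<Sum>j\<le>k. if l \<le> j then c k j * b l j else 0) - es ! k * c k l)"
    have w: "w i = (\<Sum>l<k. a l * p l i)" if "i < n" for i
    proof -
      have "(\<Sum>j\<le>k. c k j * (\<Sum>l\<le>j. b l j * p l i))
          = (\<Sum>j\<le>k. \<Sum>l\<le>k. (if l \<le> j then c k j * b l j else 0) * p l i)"
        unfolding sum_distrib_left
        by (intro sum.cong refl sum.mono_neutral_cong_left) auto
      also have "\<dots> = (\<Sum>l\<le>k. (\<Sum>j\<le>k. if l \<le> j then c k j * b l j else 0) * p l i)"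
        by (subst sum.swap) (simp add: sum_distrib_right)
      finally have "w i = (\<Sum>l\<le>k. (\<Sum>j\<le>k. if l \<le> j then c k j * b l j else 0) * p l i)
          - es ! k * (\<Sum>l\<le>k. c k l * p l i)"
        unfolding w_def Au[OF that] unfolding u_def by (rule arg_cong)
      also have "\<dots> = (\<Sum>l\<le>k. a l * p l i)"
        unfolding a_def left_diff_distrib sum_subtractf sum_distrib_left[of "es ! k"] mult.assoc[of "es ! k"] ..
      also have "\<dots> = (\<Sum>l<k. a l * p l i) + a k * p k i"
        unfolding lessThan_Suc_atMost[symmetric] by (rule sum.lessThan_Suc)
      \<comment> \<open>The diagonal entry \<open>b k k\<close> is \<open>es ! k\<close>, so the
        component along \<open>p k\<close> cancels.\<close>
      also have "a k = 0"
      proof -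
        have "(\<Sum>j\<le>k. if k \<le> j then c k j * b k j else 0) = (\<Sum>j\<in>{k}. c k j * b k j)"
          by (intro sum.mono_neutral_cong_right) auto
        then show ?thesis using k by (simp add: a_def bd)
      qed
      finally show ?thesis by simp
    qed
    have "(\<Sum>i<n. cnj (p l i) * w i) = 0" if l: "l < k" for l
    proof -
      have "(\<Sum>i<n. cnj (p l i) * w i) =
          (\<Sum>i<n. cnj (p l i) * (\<Sum>j<n. A i j * u k j)) - es ! k * (\<Sum>i<n. cnj (p l i) * u k i)"
        by (simp add: w_def right_diff_distrib sum_subtractf sum_distrib_left mult_ac)
      \<comment> \<open>Hermitian symmetry moves \<open>A\<close> onto \<open>p l\<close>, whose
        image stays in the span of \<open>p 0\<close> up to \<open>p l\<close>; all of these are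
        orthogonal to \<open>u k\<close>.\<close>
      also have "\<dots> = (\<Sum>i<n. cnj (\<Sum>j<n. A i j * p l j) * u k i)"
        using hermitian_form_commute[OF herm, where x = "p l" and y = "u k"] pu[OF l] by simp
      also have "\<dots> = (\<Sum>i<n. cnj (\<Sum>m\<le>l. b m l * p m i) * u k i)"
        using l k Ap by simp
      also have "\<dots> = 0" by (rule span_orth) (use l in auto)
      finally show ?thesis .
    qed
    then have "(\<Sum>l<k. cnj (a l) * (\<Sum>i<n. cnj (p l i) * w i)) = 0" by simp
    moreover have "(\<Sum>l<k. cnj (a l) * (\<Sum>i<n. cnj (p l i) * w i)) = (\<Sum>i<n. cnj (w i) * w i)"
    proof -
      have "(\<Sum>l<k. cnj (a l) * (\<Sum>i<n. cnj (p l i) * w i)) = (\<Sum>l<k. \<Sum>i<n. cnj (a l) * cnj (p l i) * w i)"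
        by (simp add: sum_distrib_left mult_ac)
      also have "\<dots> = (\<Sum>i<n. cnj (\<Sum>l<k. a l * p l i) * w i)"
        by (subst sum.swap) (simp add: sum_distrib_right)
      finally show ?thesis using w by simp
    qed
    ultimately have "(\<Sum>i<n. cnj (w i) * w i) = 0" by simp
    then have "w i = 0" by (rule inner_self_sum_zero) fact
    then show ?thesis by (simp add: w_def)
  qed
  show ?thesis
    by (rule that[of es u]) (use es M_def ev nz orth in auto)
qed

subsection \<open>Essential range and Toeplitz forms\<close>

definition trig_sum :: "nat \<Rightarrow> (nat \<Rightarrow> complex) \<Rightarrow> real \<Rightarrow> complex" where
  "trig_sum n x \<theta> = (\<Sum>j<n. x j * exp (\<i> * of_nat j * of_real \<theta>))"

text \<open>Second countability is the reason. Only countably many basic open sets have a null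
  preimage, so almost every \<open>x\<close> avoids them all; for such \<open>x\<close>, each ball
  around \<open>g x\<close> contains a basic set around \<open>g x\<close> whose preimage has
  positive measure.\<close>

lemma AE_in_essential_range:
  fixes g :: "real \<Rightarrow> 'a::{real_normed_vector, second_countable_topology}"
  assumes g: "g \<in> borel_measurable circle_measure"
  shows "AE x in circle_measure. g x \<in> essential_range g"
proof -
  obtain \<B> :: "'a set set" where \<B>: "countable \<B>" "topological_basis \<B>"
    using ex_countable_basis by blast
  define \<N> where "\<N> = {B \<in> \<B>. AE x in circle_measure. g x \<notin> B}"
  have "AE x in circle_measure. \<forall>B\<in>\<N>. g x \<notin> B"
    using \<B>(1) by (subst AE_ball_countable) (auto simp: \<N>_def)
  then show ?thesis
  proof eventually_elim
    case (elim x)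
    show ?case unfolding essential_range_def
    proof (intro CollectI allI impI)
      fix \<epsilon> :: real assume "\<epsilon> > 0"
      then obtain B where B: "B \<in> \<B>" "g x \<in> B" "B \<subseteq> ball (g x) \<epsilon>"
        using topological_basisE[OF \<B>(2) open_ball, of "g x" "g x" \<epsilon>] by auto
      have "open B" using topological_basis_open[OF \<B>(2) B(1)] .
      then have mB: "g -` B \<inter> space circle_measure \<in> sets circle_measure"
        by (intro measurable_sets[OF g]) simp
      have mball: "g -` ball (g x) \<epsilon> \<inter> space circle_measure \<in> sets circle_measure"
        by (intro measurable_sets[OF g]) simp
      have "B \<notin> \<N>" using elim B by blast
      then have "\<not> (AE y in circle_measure. g y \<notin> B)" using B by (simp add: \<N>_def)
      moreover have "{y \<in> space circle_measure. \<not> g y \<notin> B} = g -` B \<inter> space circle_measure"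
        by auto
      ultimately have "emeasure circle_measure (g -` B \<inter> space circle_measure) \<noteq> 0"
        using AE_iff_measurable[OF mB, of "\<lambda>y. g y \<notin> B"] by simp
      moreover have "emeasure circle_measure (g -` B \<inter> space circle_measure)
          \<le> emeasure circle_measure (g -` ball (g x) \<epsilon> \<inter> space circle_measure)"
        by (rule emeasure_mono[OF _ mball]) (use B(3) in blast)
      moreover have "g -` ball (g x) \<epsilon> \<inter> space circle_measure = {y \<in> {-pi..pi}. norm (g y - g x) < \<epsilon>}"
        by (auto simp: dist_norm norm_minus_commute)
      ultimately show "0 < emeasure circle_measure {y \<in> {-pi..pi}. norm (g y - g x) < \<epsilon>}"
        by (simp only: zero_less_iff_neq_zero) (metis le_zero_eq)
    qed
  qed
qed

lemma AE_le_ess_sup: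
  fixes g :: "real \<Rightarrow> real"
  assumes "g \<in> borel_measurable circle_measure"
  shows "AE x in circle_measure. ereal (g x) \<le> ess_sup g"
  using AE_in_essential_range[OF assms]
  by eventually_elim (auto simp: ess_sup_def intro: SUP_upper)

section \<open>Integration over the circle\<close>

lemma emeasure_circle_measure: "emeasure circle_measure (space circle_measure) = ennreal (2 * pi)"
  by (simp add: emeasure_restrict_space)

lemma finite_measure_circle_measure: "finite_measure circle_measure"
  by (rule finite_measureI) (metis emeasure_circle_measure ennreal_neq_top infinity_ennreal_def)

lemma AE_circle_measure_ex:
  assumes "AE x in circle_measure. P x" shows "\<exists>x\<in>{-pi..pi}. P x"
proof (rule ccontr)
  assume "\<not> ?thesis"
  then have "AE x in circle_measure. \<not> P x" by (intro AE_I2) simp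
  with assms have "AE x in circle_measure. False" by eventually_elim simp
  then have "emeasure circle_measure (space circle_measure) = 0"
    by (subst (asm) AE_iff_measurable[OF sets.top]) auto
  then show False unfolding emeasure_circle_measure by simp
qed

lemma continuous_borel_measurable_circle:
  fixes g :: "real \<Rightarrow> 'a::topological_space"
  assumes "continuous_on {-pi..pi} g"
  shows "g \<in> borel_measurable circle_measure"
  by (rule continuous_imp_measurable_on_sets_lebesgue[OF assms]) simp

lemma integrable_mult_continuous_circle:
  fixes f g :: "real \<Rightarrow> 'a::{real_normed_field, banach, second_countable_topology}"
  assumes f: "integrable circle_measure f" and g: "continuous_on {-pi..pi} g"
  shows "integrable circle_measure (\<lambda>x. f x * g x)"
proof -
  obtain K where K: "\<And>x. x \<in> {-pi..pi} \<Longrightarrow> norm (g x) \<le> K"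
    using compact_imp_bounded[OF compact_continuous_image[OF g compact_Icc]]
    unfolding bounded_iff by blast
  show ?thesis
  proof (rule Bochner_Integration.integrable_bound)
    show "integrable circle_measure (\<lambda>x. K * norm (f x))" using f by simp
    show "(\<lambda>x. f x * g x) \<in> borel_measurable circle_measure"
      using f continuous_borel_measurable_circle[OF g] by (intro borel_measurable_times) auto
    show "AE x in circle_measure. norm (f x * g x) \<le> norm (K * norm (f x))"
    proof (rule AE_I2)
      fix x assume "x \<in> space circle_measure"
      then have "norm (g x) \<le> K" using K by simp
      moreover from this have "0 \<le> K" by (rule order_trans[rotated]) simp
      ultimately show "norm (f x * g x) \<le> norm (K * norm (f x))"
        by (simp add: norm_mult mult.commute[of K] mult_left_mono)
    qed
  qed
qed

lemma integrable_continuous_circle: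
  fixes g :: "real \<Rightarrow> 'a::{real_normed_field, banach, second_countable_topology}"
  assumes g: "continuous_on {-pi..pi} g"
  shows "integrable circle_measure g"
proof -
  interpret finite_measure circle_measure by (rule finite_measure_circle_measure)
  show ?thesis using integrable_mult_continuous_circle[OF _ g, of "\<lambda>_. 1"] by simp
qed

section \<open>Trigonometric sums: orthogonality, zeros, Toeplitz forms and Parseval\<close>

lemma continuous_trig_sum: "continuous_on S (trig_sum n x)"
  unfolding trig_sum_def[abs_def] by (intro continuous_intros)

lemma integral_exp_circle:
  "(\<integral>\<theta>. exp (\<i> * of_int k * of_real \<theta>) \<partial>circle_measure) = (if k = 0 then 2 * of_real pi else 0)"
proof (cases "k = 0")
  case True
  have "measure circle_measure (space circle_measure) = 2 * pi"
    unfolding measure_def emeasure_circle_measure by simp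
  then show ?thesis using True by (simp add: scaleR_conv_of_real)
next
  case False
  \<comment> \<open>An antiderivative with period \<open>2 * pi\<close>, which therefore takes equal
    values at both endpoints.\<close>
  define G where "G = (\<lambda>\<theta>. exp (\<i> * of_int k * of_real \<theta>) / (\<i> * of_int k))"
  have "((\<lambda>\<theta>. exp (\<i> * of_int k * of_real \<theta>)) has_integral (G pi - G (-pi))) {-pi..pi}"
  proof (rule fundamental_theorem_of_calculus)
    fix x :: real
    show "(G has_vector_derivative exp (\<i> * of_int k * of_real x)) (at x within {-pi..pi})"
      unfolding G_def using False
      by (intro has_vector_derivative_real_field[where f = "\<lambda>z. exp (\<i> * of_int k * z) / (\<i> * of_int k)"])
        (auto intro!: derivative_eq_intros)
  qed simp
  moreover have "G pi - G (- pi) = 0"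
  proof -
    have "exp (\<i> * of_int k * of_real pi) = exp (\<i> * of_int k * of_real (- pi))"
      by (subst exp_eq) (auto intro!: exI[of _ k])
    then show ?thesis by (simp add: G_def)
  qed
  ultimately have "integral {-pi..pi} (\<lambda>\<theta>. exp (\<i> * of_int k * of_real \<theta>)) = 0"
    by (simp add: integral_unique)
  moreover have "integrable circle_measure (\<lambda>\<theta>. exp (\<i> * of_int k * of_real \<theta>))"
    by (intro integrable_continuous_circle continuous_intros)
  ultimately show ?thesis using False by (simp add: lebesgue_integral_eq_integral)
qed

text \<open>The sum is a nonzero polynomial evaluated at the point \<open>cis \<theta>\<close> of
  the unit circle, so it has only finitely many zeros in the interval.\<close>

lemma AE_trig_sum_nonzero:
  assumes "\<exists>j<n. x j \<noteq> 0"
  shows "AE \<theta> in circle_measure. trig_sum n x \<theta> \<noteq> 0"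
proof -
  define p where "p = (\<Sum>j<n. monom (x j) j)"
  have "coeff p j = x j" if "j < n" for j
    using that by (simp add: p_def coeff_sum if_distrib cong: if_cong)
  then have "p \<noteq> 0" using assms by auto
  then have fin: "finite {z. poly p z = 0}" by (rule poly_roots_finite)
  have eq: "trig_sum n x \<theta> = poly p (cis \<theta>)" for \<theta>
    by (simp add: trig_sum_def p_def poly_sum poly_monom cis_conv_exp exp_of_nat_mult[symmetric] mult_ac)
  have inj: "inj_on cis {-pi<..pi}"
    by (metis (no_types, lifting) cis_Arg_unique greaterThanAtMost_iff inj_onI norm_cis sgn_cis)
  have "finite (cis -` {z. poly p z = 0} \<inter> {-pi<..pi})"
    by (rule finite_vimage_IntI[OF fin inj])
  \<comment> \<open>\<open>cis\<close> is injective on the half-open interval only, so the left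
    endpoint is added by hand.\<close>
  then have "finite (insert (-pi) (cis -` {z. poly p z = 0} \<inter> {-pi<..pi}))" by simp
  then have "insert (-pi) (cis -` {z. poly p z = 0} \<inter> {-pi<..pi}) \<in> null_sets lebesgue"
    by (rule finite_imp_null_set_lborel[THEN null_sets_completionI])
  then have "AE \<theta> in lebesgue. \<theta> \<notin> insert (-pi) (cis -` {z. poly p z = 0} \<inter> {-pi<..pi})"
    by (rule AE_not_in)
  then show ?thesis
    unfolding eq by (subst AE_restrict_space_iff) (auto elim: eventually_elim2)
qed

text \<open>Expanding the product of the two sums leaves the exponentials
  \<open>exp (- \<i> (i - j) \<theta>)\<close>, whose integrals against \<open>f\<close> are the
  Fourier coefficients up to the factor \<open>2 * pi\<close>.\<close>

lemma toeplitz_form: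
  assumes f: "integrable circle_measure f"
  shows "(\<Sum>i<n. \<Sum>j<n. cnj (y i) * fourier_coeff f (int i - int j) * x j)
    = 1 / (2 * of_real pi) * (\<integral>\<theta>. f \<theta> * (cnj (trig_sum n y \<theta>) * trig_sum n x \<theta>) \<partial>circle_measure)"
proof -
  let ?e = "\<lambda>k \<theta>. exp (- (\<i> * of_int k * of_real \<theta>)) :: complex"
  have int: "integrable circle_measure (\<lambda>\<theta>. f \<theta> * ?e k \<theta>)" for k
    by (rule integrable_mult_continuous_circle[OF f]) (intro continuous_intros)
  have expand: "f \<theta> * (cnj (trig_sum n y \<theta>) * trig_sum n x \<theta>) =
      (\<Sum>i<n. \<Sum>j<n. cnj (y i) * x j * (f \<theta> * ?e (int i - int j) \<theta>))" for \<theta>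
  proof -
    have e: "?e (int i - int j) \<theta> = exp (- (\<i> * of_nat i * of_real \<theta>)) * exp (\<i> * of_nat j * of_real \<theta>)" for i j
      by (simp add: exp_add[symmetric] algebra_simps)
    have "f \<theta> * (cnj (trig_sum n y \<theta>) * trig_sum n x \<theta>) = f \<theta> *
        ((\<Sum>i<n. cnj (y i) * exp (- (\<i> * of_nat i * of_real \<theta>))) * (\<Sum>j<n. x j * exp (\<i> * of_nat j * of_real \<theta>)))"
      by (simp add: trig_sum_def exp_cnj)
    also have "\<dots> = (\<Sum>i<n. \<Sum>j<n. f \<theta> * ((cnj (y i) * exp (- (\<i> * of_nat i * of_real \<theta>))) * (x j * exp (\<i> * of_nat j * of_real \<theta>))))"
      unfolding sum_product unfolding sum_distrib_left ..
    finally show ?thesis unfolding e by (simp add: mult_ac)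
  qed
  have "(\<integral>\<theta>. f \<theta> * (cnj (trig_sum n y \<theta>) * trig_sum n x \<theta>) \<partial>circle_measure)
      = (\<Sum>i<n. \<Sum>j<n. cnj (y i) * x j * (\<integral>\<theta>. f \<theta> * ?e (int i - int j) \<theta> \<partial>circle_measure))"
    unfolding expand
    by (subst Bochner_Integration.integral_sum, intro Bochner_Integration.integrable_sum integrable_mult_right int,
        intro sum.cong refl, subst Bochner_Integration.integral_sum, intro integrable_mult_right int)
      (simp only: integral_mult_right_zero)
  then show ?thesis
    by (simp only: fourier_coeff_def sum_distrib_left mult_ac)
qed

lemma fourier_coeff_one: "fourier_coeff (\<lambda>_. 1) k = (if k = 0 then 1 else 0)"
  using integral_exp_circle[of "- k"] by (simp add: fourier_coeff_def)

text \<open>The Toeplitz form of the constant symbol \<open>1\<close>, whose Toeplitz matrix is the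
  identity.\<close>

lemma trig_sum_parseval:
  "(\<integral>\<theta>. (cmod (trig_sum n x \<theta>))\<^sup>2 \<partial>circle_measure) = 2 * pi * (\<Sum>i<n. (cmod (x i))\<^sup>2)"
proof -
  interpret finite_measure circle_measure by (rule finite_measure_circle_measure)
  have "(\<Sum>i<n. \<Sum>j<n. cnj (x i) * fourier_coeff (\<lambda>_. 1) (int i - int j) * x j) = (\<Sum>i<n. cnj (x i) * x i)"
    by (intro sum.cong refl) (simp add: fourier_coeff_one if_distrib if_distribR cong: if_cong)
  also have "\<dots> = of_real (\<Sum>i<n. (cmod (x i))\<^sup>2)"
    unfolding of_real_sum complex_norm_square by (simp only: mult.commute)
  finally have "of_real (\<Sum>i<n. (cmod (x i))\<^sup>2) =
      1 / (2 * of_real pi) * (\<integral>\<theta>. cnj (trig_sum n x \<theta>) * trig_sum n x \<theta> \<partial>circle_measure)"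
    using toeplitz_form[where f = "\<lambda>_. 1" and n = n and x = x and y = x] by (simp del: of_real_sum)
  also have "(\<lambda>\<theta>. cnj (trig_sum n x \<theta>) * trig_sum n x \<theta>) = (\<lambda>\<theta>. of_real ((cmod (trig_sum n x \<theta>))\<^sup>2))"
    unfolding complex_norm_square by (simp only: mult.commute)
  finally have "complex_of_real (\<Sum>i<n. (cmod (x i))\<^sup>2) =
      of_real (1 / (2 * pi) * (\<integral>\<theta>. (cmod (trig_sum n x \<theta>))\<^sup>2 \<partial>circle_measure))"
    unfolding integral_complex_of_real by (simp del: of_real_sum)
  then have "(\<Sum>i<n. (cmod (x i))\<^sup>2) = 1 / (2 * pi) * (\<integral>\<theta>. (cmod (trig_sum n x \<theta>))\<^sup>2 \<partial>circle_measure)"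
    by (simp only: of_real_eq_iff)
  then show ?thesis by (simp add: field_simps)
qed

subsection \<open>Bounds for eigenvalues\<close>

text \<open>The witness is the point of the closed convex hull nearest to zero. Passing to the
  closure keeps the distance and guarantees that the point exists; the inequality says that
  \<open>S\<close> lies beyond the supporting hyperplane at \<open>a\<close>, and it is trivial if
  \<open>a = 0\<close>.\<close>

lemma nearest_point_convex_hull:
  fixes S :: "'a::euclidean_space set"
  assumes "S \<noteq> {}"
  shows "\<exists>a. infdist 0 (convex hull S) \<le> norm a \<and> (\<forall>s\<in>S. (norm a)\<^sup>2 \<le> inner a s)"
proof -
  define C where "C = closure (convex hull S)"
  have C: "closed C" "convex C" "C \<noteq> {}"
    using assms by (simp_all add: C_def convex_closure)
  define a where "a = closest_point C 0"
  note a = closest_point_exists[OF C(1,3), of 0, folded a_def]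
  have "infdist 0 (convex hull S) = infdist 0 C"
    by (simp only: C_def infdist_eq_setdist setdist_closure_2)
  then have "infdist 0 (convex hull S) \<le> norm a"
    using infdist_le[OF a(1), of 0] by simp
  moreover have "(norm a)\<^sup>2 \<le> inner a s" if "s \<in> S" for s
  proof -
    have "s \<in> C" using hull_inc[OF that, of convex] closure_subset unfolding C_def by blast
    \<comment> \<open>The variational inequality \<open>inner (0 - a) (s - a) \<le> 0\<close> of the
      projection of zero.\<close>
    from any_closest_point_dot[OF C(2,1) a(1) this a(2)]
    show ?thesis by (simp add: inner_diff_right power2_norm_eq_inner)
  qed
  ultimately show ?thesis by blast
qed

text \<open>The exchange matrix reverses the rows. The entries then depend on \<open>i + j\<close>
  only, so the matrix is Hankel and symmetric, and real coefficients make it Hermitian.\<close>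

lemma flipped_toeplitz_eq:
  "flipped_toeplitz n f = Matrix.mat n n (\<lambda>(i, j). fourier_coeff f (int n - 1 - int i - int j))"
proof (rule eq_matI)
  fix i j assume "i < dim_row (Matrix.mat n n (\<lambda>(i, j). fourier_coeff f (int n - 1 - int i - int j)))"
    "j < dim_col (Matrix.mat n n (\<lambda>(i, j). fourier_coeff f (int n - 1 - int i - int j)))"
  then have ij: "i < n" "j < n" by auto
  have "flipped_toeplitz n f $$ (i, j) =
      (\<Sum>k<n. (if i + k + 1 = n then 1 else 0) * fourier_coeff f (int k - int j))"
    using ij by (simp add: flipped_toeplitz_def exchange_mat_def toeplitz_def scalar_prod_def lessThan_atLeast0)
  also have "\<dots> = (\<Sum>k\<in>{n - 1 - i}. fourier_coeff f (int k - int j))"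
    using ij by (intro sum.mono_neutral_cong_right) auto
  also have "\<dots> = fourier_coeff f (int n - 1 - int i - int j)"
    using ij by (simp add: of_nat_diff algebra_simps)
  finally show "flipped_toeplitz n f $$ (i, j) =
      Matrix.mat n n (\<lambda>(i, j). fourier_coeff f (int n - 1 - int i - int j)) $$ (i, j)"
    using ij by simp
qed (auto simp: flipped_toeplitz_def exchange_mat_def toeplitz_def)

text \<open>Reversing the rows twice restores them: row \<open>n - 1 - i\<close> of the flipped
  matrix is row \<open>i\<close> of the Toeplitz matrix.\<close>

lemma hankel_sum_eq_toeplitz_sum:
  assumes "i < n"
  shows "(\<Sum>j<n. fourier_coeff f (int n - 1 - int (n - Suc i) - int j) * x j)
       = (\<Sum>j<n. fourier_coeff f (int i - int j) * x j)"
  using assms by (intro sum.cong refl) (simp add: of_nat_diff)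

lemma flipped_toeplitz_eigenvalueE:
  assumes "eigenvalue (flipped_toeplitz n f) z"
  obtains x where "\<exists>i<n. x i \<noteq> 0"
    "\<And>i. i < n \<Longrightarrow> (\<Sum>j<n. fourier_coeff f (int n - 1 - int i - int j) * x j) = z * x i"
proof -
  have dim: "dim_row (flipped_toeplitz n f) = n" by (simp add: flipped_toeplitz_eq)
  obtain v where v: "v \<in> carrier_vec n" "v \<noteq> 0\<^sub>v n" "flipped_toeplitz n f *\<^sub>v v = z \<cdot>\<^sub>v v"
    using assms by (auto simp: eigenvalue_def eigenvector_def dim)
  show ?thesis
  proof (rule that)
    show "\<exists>i<n. v $ i \<noteq> 0" using v by (metis carrier_vecD eq_vecI index_zero_vec)
    fix i assume i: "i < n"
    have "(flipped_toeplitz n f *\<^sub>v v) $ i = (\<Sum>j<n. fourier_coeff f (int n - 1 - int i - int j) * v $ j)"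
      using i v(1) by (simp add: flipped_toeplitz_eq scalar_prod_def lessThan_atLeast0)
    then show "(\<Sum>j<n. fourier_coeff f (int n - 1 - int i - int j) * v $ j) = z * v $ i"
      using i v by simp
  qed
qed

lemma norm_square_sum_pos:
  fixes x :: "nat \<Rightarrow> complex"
  assumes "\<exists>i<n. x i \<noteq> 0" shows "0 < (\<Sum>i<n. (cmod (x i))\<^sup>2)"
proof -
  obtain i where "i < n" "x i \<noteq> 0" using assms by blast
  then show ?thesis by (intro sum_pos2[of _ i]) auto
qed

lemma mult_le_mean_square: "(a::real) * b \<le> (a\<^sup>2 + b\<^sup>2) / 2"
  using sum_squares_bound[of a b] by simp

text \<open>The eigenvalue equation of the flipped matrix, multiplied by the exchange matrix, which is
  its own inverse.\<close>
locale flipped_eigenvector =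
  fixes f :: "real \<Rightarrow> complex" and n :: nat and x :: "nat \<Rightarrow> complex" and z :: complex
  assumes f: "integrable circle_measure f"
    and nonzero: "\<exists>i<n. x i \<noteq> 0"
    and toeplitz_eq: "\<And>i. i < n \<Longrightarrow>
      (\<Sum>j<n. fourier_coeff f (int i - int j) * x j) = z * x (n - Suc i)"
begin

text \<open>The exchange matrix applied to \<open>x\<close>, so that \<open>toeplitz_eq\<close>
  reads \<open>T x = z y\<close>.\<close>

definition y :: "nat \<Rightarrow> complex" where "y i = x (n - Suc i)"

definition S :: real where "S = (\<Sum>i<n. (cmod (x i))\<^sup>2)"

text \<open>The arithmetic-geometric majorant of \<open>|p_y| |p_x|\<close>, where
  \<open>p_v\<close> stands for \<open>trig_sum n v\<close>. Unlike that product, its integral is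
  known exactly from Parseval.\<close>

definition w :: "real \<Rightarrow> real" where
  "w \<theta> = ((cmod (trig_sum n y \<theta>))\<^sup>2 + (cmod (trig_sum n x \<theta>))\<^sup>2) / 2"

lemma S_pos: "0 < S"
  using norm_square_sum_pos[OF nonzero] by (simp add: S_def)

lemma S_flip: "(\<Sum>i<n. (cmod (y i))\<^sup>2) = S"
  unfolding y_def S_def by (rule sum.nat_diff_reindex)

text \<open>The test vector \<open>v\<close> stays free: \<open>v = y\<close> gives the upper bounds
  and \<open>v = x\<close> the lower one.\<close>

lemma form: "(\<Sum>i<n. \<Sum>j<n. cnj (v i) * fourier_coeff f (int i - int j) * x j) = z * (\<Sum>i<n. cnj (v i) * y i)"
proof -
  have "(\<Sum>i<n. \<Sum>j<n. cnj (v i) * fourier_coeff f (int i - int j) * x j)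
      = (\<Sum>i<n. cnj (v i) * (\<Sum>j<n. fourier_coeff f (int i - int j) * x j))"
    by (simp add: sum_distrib_left mult.assoc)
  also have "\<dots> = (\<Sum>i<n. cnj (v i) * (z * y i))"
    by (intro sum.cong refl) (simp add: toeplitz_eq y_def)
  finally show ?thesis by (simp add: sum_distrib_left mult_ac)
qed

lemma w_continuous: "continuous_on A w"
  unfolding w_def[abs_def] by (intro continuous_intros continuous_trig_sum) simp

lemma w_nonneg: "0 \<le> w \<theta>"
  by (simp add: w_def)

lemma integral_w: "(\<integral>\<theta>. w \<theta> \<partial>circle_measure) = 2 * pi * S"
proof -
  have int: "integrable circle_measure (\<lambda>\<theta>. (cmod (trig_sum n v \<theta>))\<^sup>2)" for v
    by (intro integrable_continuous_circle continuous_intros continuous_trig_sum)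
  show ?thesis unfolding w_def[abs_def]
    by (simp add: int trig_sum_parseval S_flip S_def[symmetric])
qed

lemma integrable_f_w: "integrable circle_measure (\<lambda>\<theta>. cmod (f \<theta>) * w \<theta>)"
  by (intro integrable_mult_continuous_circle w_continuous integrable_norm f)

text \<open>Testing with \<open>y\<close> turns the form into \<open>z * S\<close>, because
  \<open>y\<close> is a permutation of \<open>x\<close>. The triangle inequality and the majorant
  \<open>w\<close> do the rest.\<close>

lemma norm_le_integral: "2 * pi * S * cmod z \<le> (\<integral>\<theta>. cmod (f \<theta>) * w \<theta> \<partial>circle_measure)"
proof -
  have "(\<Sum>i<n. cnj (y i) * y i) = of_real S"
    unfolding S_flip[symmetric] of_real_sum complex_norm_square by (simp only: mult.commute)
  then have "z * of_real S = 1 / (2 * of_real pi) *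
      (\<integral>\<theta>. f \<theta> * (cnj (trig_sum n y \<theta>) * trig_sum n x \<theta>) \<partial>circle_measure)"
    using toeplitz_form[OF f, where n = n and x = x and y = y] form[of y] by simp
  then have eq: "of_real (2 * pi * S) * z =
      (\<integral>\<theta>. f \<theta> * (cnj (trig_sum n y \<theta>) * trig_sum n x \<theta>) \<partial>circle_measure)"
  proof -
    assume e: "z * of_real S = 1 / (2 * of_real pi) *
      (\<integral>\<theta>. f \<theta> * (cnj (trig_sum n y \<theta>) * trig_sum n x \<theta>) \<partial>circle_measure)"
    have "of_real (2 * pi * S) * z = 2 * of_real pi * (z * of_real S)" by simp
    then show ?thesis unfolding e by simp
  qed
  have "2 * pi * S * cmod z = cmod (of_real (2 * pi * S) * z)"
    unfolding norm_mult[of "of_real _"] norm_of_real using S_pos by simp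
  also have "\<dots> = cmod (\<integral>\<theta>. f \<theta> * (cnj (trig_sum n y \<theta>) * trig_sum n x \<theta>) \<partial>circle_measure)"
    by (rule arg_cong[OF eq])
  also have "\<dots> \<le> (\<integral>\<theta>. cmod (f \<theta> * (cnj (trig_sum n y \<theta>) * trig_sum n x \<theta>)) \<partial>circle_measure)"
    by (rule integral_norm_bound)
  also have "\<dots> \<le> (\<integral>\<theta>. cmod (f \<theta>) * w \<theta> \<partial>circle_measure)"
  proof (rule integral_mono)
    show "integrable circle_measure (\<lambda>\<theta>. cmod (f \<theta> * (cnj (trig_sum n y \<theta>) * trig_sum n x \<theta>)))"
      by (intro integrable_norm integrable_mult_continuous_circle f continuous_intros continuous_trig_sum)
    show "integrable circle_measure (\<lambda>\<theta>. cmod (f \<theta>) * w \<theta>)" by (rule integrable_f_w)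
    show "cmod (f \<theta> * (cnj (trig_sum n y \<theta>) * trig_sum n x \<theta>)) \<le> cmod (f \<theta>) * w \<theta>" for \<theta>
      unfolding norm_mult w_def complex_mod_cnj by (intro mult_left_mono mult_le_mean_square) simp
  qed
  finally show ?thesis .
qed

lemma norm_le:
  assumes "AE \<theta> in circle_measure. cmod (f \<theta>) \<le> C"
  shows "cmod z \<le> C"
proof -
  have "(\<integral>\<theta>. cmod (f \<theta>) * w \<theta> \<partial>circle_measure) \<le> (\<integral>\<theta>. C * w \<theta> \<partial>circle_measure)"
    by (rule integral_mono_AE[OF integrable_f_w])
      (use assms in \<open>auto intro!: integrable_mult_right integrable_continuous_circle w_continuous
         elim!: eventually_mono mult_right_mono[OF _ w_nonneg]\<close>)
  also have "\<dots> = 2 * pi * S * C" by (simp add: integral_w)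
  finally have "2 * pi * S * cmod z \<le> 2 * pi * S * C"
    by (rule order_trans[OF norm_le_integral])
  then show ?thesis by (rule mult_left_le_imp_le) (use S_pos in simp)
qed

text \<open>If the bound \<open>C\<close> were reached, the nonnegative function
  \<open>(C - |f|) w\<close> would have integral zero and vanish almost everywhere. Since
  \<open>w\<close> is positive off a null set, \<open>|f|\<close> would equal \<open>C\<close>
  almost everywhere.\<close>

lemma norm_less:
  assumes C: "AE \<theta> in circle_measure. cmod (f \<theta>) \<le> C"
    and nc: "\<not> (AE \<theta> in circle_measure. cmod (f \<theta>) = C)"
  shows "cmod z < C"
proof (rule ccontr)
  assume "\<not> ?thesis"
  then have "C \<le> cmod z" by simp
  have int: "integrable circle_measure (\<lambda>\<theta>. C * w \<theta>)"
    by (intro integrable_mult_right integrable_continuous_circle w_continuous)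
  have nn: "AE \<theta> in circle_measure. 0 \<le> C * w \<theta> - cmod (f \<theta>) * w \<theta>"
    using C by eventually_elim (simp add: mult_right_mono w_nonneg)
  have "(\<integral>\<theta>. C * w \<theta> - cmod (f \<theta>) * w \<theta> \<partial>circle_measure) = C * (2 * pi * S) - (\<integral>\<theta>. cmod (f \<theta>) * w \<theta> \<partial>circle_measure)"
    using int integrable_f_w by (simp add: integral_w)
  also have "\<dots> \<le> C * (2 * pi * S) - cmod z * (2 * pi * S)"
    using norm_le_integral by (simp add: mult.commute)
  also have "\<dots> \<le> 0" using \<open>C \<le> cmod z\<close> S_pos by simp
  finally have "(\<integral>\<theta>. C * w \<theta> - cmod (f \<theta>) * w \<theta> \<partial>circle_measure) = 0"
    using integral_nonneg_AE[OF nn] by linarith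
  then have "AE \<theta> in circle_measure. C * w \<theta> - cmod (f \<theta>) * w \<theta> = 0"
    using integral_nonneg_eq_0_iff_AE[OF Bochner_Integration.integrable_diff[OF int integrable_f_w] nn] by blast
  then have "AE \<theta> in circle_measure. cmod (f \<theta>) = C"
    using AE_trig_sum_nonzero[OF nonzero]
  proof eventually_elim
    case (elim \<theta>)
    then have "w \<theta> > 0" by (simp add: w_def add_nonneg_pos)
    with elim show ?case by (simp add: left_diff_distrib[symmetric])
  qed
  with nc show False by simp
qed

text \<open>Testing with \<open>x\<close> itself gives a mean of \<open>f\<close> against the
  nonnegative weight \<open>|p_x|^2\<close>, with \<open>p_x\<close> for
  \<open>trig_sum n x\<close>. Its component along the nearest point \<open>a\<close> is at least
  \<open>|a|^2\<close> times the mass of the weight, whereas the eigenvalue equation bounds the form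
  by \<open>S * |z|\<close>.\<close>

lemma norm_ge: "infdist 0 (convex hull (essential_range f)) \<le> cmod z"
proof -
  have AE: "AE \<theta> in circle_measure. f \<theta> \<in> essential_range f"
    by (intro AE_in_essential_range borel_measurable_integrable f)
  from AE_circle_measure_ex[OF this] have "essential_range f \<noteq> {}" by auto
  from nearest_point_convex_hull[OF this]
  obtain a where a: "infdist 0 (convex hull (essential_range f)) \<le> cmod a"
    "\<forall>s\<in>essential_range f. (cmod a)\<^sup>2 \<le> inner a s" by blast
  let ?p = "\<lambda>\<theta>. (cmod (trig_sum n x \<theta>))\<^sup>2"
  define q where "q = z * (\<Sum>i<n. cnj (x i) * y i)"
  \<comment> \<open>Written as a real multiple of \<open>f\<close>, so that \<open>inner a\<close>
    passes under the integral and the weight factors out of it.\<close>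
  have fp: "integrable circle_measure (\<lambda>\<theta>. ?p \<theta> *\<^sub>R f \<theta>)"
    unfolding scaleR_conv_of_real mult.commute[of "of_real _"]
    by (intro integrable_mult_continuous_circle f continuous_intros continuous_trig_sum)
  have p: "integrable circle_measure ?p"
    by (intro integrable_continuous_circle continuous_intros continuous_trig_sum)
  have "q = 1 / (2 * of_real pi) * (\<integral>\<theta>. f \<theta> * (cnj (trig_sum n x \<theta>) * trig_sum n x \<theta>) \<partial>circle_measure)"
    unfolding q_def form[of x, symmetric] by (rule toeplitz_form[OF f])
  also have "(\<lambda>\<theta>. f \<theta> * (cnj (trig_sum n x \<theta>) * trig_sum n x \<theta>)) = (\<lambda>\<theta>. ?p \<theta> *\<^sub>R f \<theta>)"
    unfolding scaleR_conv_of_real complex_norm_square by (simp only: mult_ac)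
  finally have q: "(2 * pi) *\<^sub>R q = (\<integral>\<theta>. ?p \<theta> *\<^sub>R f \<theta> \<partial>circle_measure)"
    by (simp add: scaleR_conv_of_real)
  have "2 * pi * S * (cmod a)\<^sup>2 = (\<integral>\<theta>. (cmod a)\<^sup>2 * ?p \<theta> \<partial>circle_measure)"
    by (simp add: trig_sum_parseval S_def)
  also have "\<dots> \<le> (\<integral>\<theta>. inner a (?p \<theta> *\<^sub>R f \<theta>) \<partial>circle_measure)"
  proof (rule integral_mono_AE)
    show "integrable circle_measure (\<lambda>\<theta>. (cmod a)\<^sup>2 * ?p \<theta>)" using p by simp
    show "integrable circle_measure (\<lambda>\<theta>. inner a (?p \<theta> *\<^sub>R f \<theta>))" using fp by (rule integrable_inner_right)
    show "AE \<theta> in circle_measure. (cmod a)\<^sup>2 * ?p \<theta> \<le> inner a (?p \<theta> *\<^sub>R f \<theta>)"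
      using AE by eventually_elim (simp add: a(2) mult.commute[of _ "(cmod (trig_sum n x _))\<^sup>2"] mult_left_mono)
  qed
  also have "\<dots> = 2 * pi * inner a q"
    using integral_inner_right[OF fp, of a] q by (metis inner_scaleR_right)
  also have "\<dots> \<le> 2 * pi * (cmod a * (S * cmod z))"
  proof -
    \<comment> \<open>Since \<open>x\<close> and \<open>y\<close> have the same norm, the
      arithmetic-geometric inequality is as good as Cauchy-Schwarz here.\<close>
    have "cmod (\<Sum>i<n. cnj (x i) * y i) \<le> (\<Sum>i<n. cmod (x i) * cmod (y i))"
      by (rule order_trans[OF norm_sum]) (simp add: norm_mult)
    also have "\<dots> \<le> (\<Sum>i<n. ((cmod (x i))\<^sup>2 + (cmod (y i))\<^sup>2) / 2)"
      by (intro sum_mono mult_le_mean_square)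
    also have "\<dots> = S"
      unfolding sum_divide_distrib[symmetric] sum.distrib S_flip by (simp add: S_def)
    finally have "cmod q \<le> S * cmod z" by (simp add: q_def norm_mult mult.commute mult_left_mono)
    then have "cmod a * cmod q \<le> cmod a * (S * cmod z)" by (simp add: mult_left_mono)
    then show ?thesis using norm_cauchy_schwarz[of a q] by simp
  qed
  finally have "(2 * pi * S) * (cmod a * cmod a) \<le> (2 * pi * S) * (cmod a * cmod z)"
    by (simp add: power2_eq_square mult_ac)
  then have "cmod a * cmod a \<le> cmod a * cmod z" using S_pos by (simp add: mult_le_cancel_left)
  then have "cmod a \<le> cmod z" by (cases "a = 0") (auto simp: mult_le_cancel_left)
  with a(1) show ?thesis by simp
qed

end

lemma flipped_eigenvectorI:
  assumes "integrable circle_measure f" "\<exists>i<n. x i \<noteq> 0"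
    and ev: "\<And>i. i < n \<Longrightarrow> (\<Sum>j<n. fourier_coeff f (int n - 1 - int i - int j) * x j) = z * x i"
  shows "flipped_eigenvector f n x z"
proof
  fix i assume i: "i < n"
  have "(\<Sum>j<n. fourier_coeff f (int i - int j) * x j) = (\<Sum>j<n. fourier_coeff f (int n - 1 - int (n - Suc i) - int j) * x j)"
    using hankel_sum_eq_toeplitz_sum[OF i] by simp
  also have "\<dots> = z * x (n - Suc i)" using i by (intro ev) simp
  finally show "(\<Sum>j<n. fourier_coeff f (int i - int j) * x j) = z * x (n - Suc i)" .
qed fact+

subsection \<open>Trigonometric polynomials\<close>

text \<open>Pythagoras for an orthogonal family that is not normalized.\<close>

lemma orthogonal_norm_square_sum:
  fixes u :: "'k \<Rightarrow> nat \<Rightarrow> complex"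
  assumes "finite K" and orth: "\<And>k l. k \<in> K \<Longrightarrow> l \<in> K \<Longrightarrow> k \<noteq> l \<Longrightarrow> (\<Sum>i<n. cnj (u k i) * u l i) = 0"
  shows "(\<Sum>i<n. (cmod (\<Sum>k\<in>K. a k * u k i))\<^sup>2) = (\<Sum>k\<in>K. (cmod (a k))\<^sup>2 * (\<Sum>i<n. (cmod (u k i))\<^sup>2))"
proof -
  have sq: "complex_of_real ((cmod v)\<^sup>2) = cnj v * v" for v
    by (simp only: complex_norm_square mult.commute)
  have "complex_of_real (\<Sum>i<n. (cmod (\<Sum>k\<in>K. a k * u k i))\<^sup>2)
      = (\<Sum>i<n. \<Sum>k\<in>K. \<Sum>l\<in>K. cnj (a k) * a l * (cnj (u k i) * u l i))"
    unfolding of_real_sum sq cnj_sum complex_cnj_mult sum_product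
    by (simp only: mult_ac)
  also have "\<dots> = (\<Sum>k\<in>K. \<Sum>l\<in>K. cnj (a k) * a l * (\<Sum>i<n. cnj (u k i) * u l i))"
    unfolding sum_distrib_left by (subst sum.swap, intro sum.cong refl, rule sum.swap)
  also have "\<dots> = (\<Sum>k\<in>K. \<Sum>l\<in>{k}. cnj (a k) * a l * (\<Sum>i<n. cnj (u k i) * u l i))"
    using assms by (intro sum.cong refl sum.mono_neutral_right) auto
  also have "\<dots> = (\<Sum>k\<in>K. (cnj (a k) * a k) * (\<Sum>i<n. cnj (u k i) * u k i))"
    by simp
  also have "\<dots> = complex_of_real (\<Sum>k\<in>K. (cmod (a k))\<^sup>2 * (\<Sum>i<n. (cmod (u k i))\<^sup>2))"
    unfolding of_real_sum of_real_mult sq ..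
  finally show ?thesis by (simp only: of_real_eq_iff)
qed

text \<open>There are more eigenvectors than conditions, so some nontrivial combination vanishes on
  \<open>J\<close>. The matrix multiplies each of its orthogonal components by a factor of modulus
  below \<open>m\<close>, and Pythagoras adds up the squares.\<close>

lemma ex_small_image_vanishing_on:
  fixes A :: "nat \<Rightarrow> nat \<Rightarrow> complex"
  assumes K: "finite K" and J: "finite J" "card J < card K"
    and ev: "\<And>k i. k \<in> K \<Longrightarrow> i < n \<Longrightarrow> (\<Sum>j<n. A i j * u k j) = e k * u k i"
    and nz: "\<And>k. k \<in> K \<Longrightarrow> \<exists>i<n. u k i \<noteq> 0"
    and orth: "\<And>k l. k \<in> K \<Longrightarrow> l \<in> K \<Longrightarrow> k \<noteq> l \<Longrightarrow> (\<Sum>i<n. cnj (u k i) * u l i) = 0"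
    and small: "\<And>k. k \<in> K \<Longrightarrow> cmod (e k) < m"
  obtains x where "\<And>j. j \<in> J \<Longrightarrow> x j = 0"
    "(\<Sum>i<n. (cmod (\<Sum>j<n. A i j * x j))\<^sup>2) < m\<^sup>2 * (\<Sum>i<n. (cmod (x i))\<^sup>2)"
proof -
  obtain c where c: "\<exists>k\<in>K. c k \<noteq> 0" "\<forall>j\<in>J. (\<Sum>k\<in>K. u k j * c k) = 0"
    using underdetermined_homogeneous_system[OF J(1) K J(2), of "\<lambda>j k. u k j"] by blast
  define x where "x = (\<lambda>j. \<Sum>k\<in>K. c k * u k j)"
  have pyth: "(\<Sum>i<n. (cmod (\<Sum>k\<in>K. a k * u k i))\<^sup>2) = (\<Sum>k\<in>K. (cmod (a k))\<^sup>2 * (\<Sum>i<n. (cmod (u k i))\<^sup>2))" for a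
    by (rule orthogonal_norm_square_sum[OF K orth])
  have pos: "0 < (\<Sum>i<n. (cmod (u k i))\<^sup>2)" if "k \<in> K" for k
    by (rule norm_square_sum_pos[OF nz[OF that]])
  have Ax: "(\<Sum>j<n. A i j * x j) = (\<Sum>k\<in>K. (c k * e k) * u k i)" if "i < n" for i
  proof -
    have "(\<Sum>j<n. A i j * x j) = (\<Sum>j<n. \<Sum>k\<in>K. c k * (A i j * u k j))"
      unfolding x_def sum_distrib_left by (simp only: mult_ac)
    also have "\<dots> = (\<Sum>k\<in>K. c k * (\<Sum>j<n. A i j * u k j))"
      unfolding sum_distrib_left by (rule sum.swap)
    also have "\<dots> = (\<Sum>k\<in>K. (c k * e k) * u k i)"
      using ev that by (intro sum.cong refl) simp
    finally show ?thesis .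
  qed
  obtain k0 where k0: "k0 \<in> K" "c k0 \<noteq> 0" using c(1) by blast
  have sm: "(cmod (e k))\<^sup>2 < m\<^sup>2" if "k \<in> K" for k
    using small[OF that] by (intro power_strict_mono) auto
  have "(\<Sum>i<n. (cmod (\<Sum>j<n. A i j * x j))\<^sup>2) = (\<Sum>i<n. (cmod (\<Sum>k\<in>K. (c k * e k) * u k i))\<^sup>2)"
    using Ax by (intro sum.cong refl) simp
  also have "\<dots> = (\<Sum>k\<in>K. (cmod (e k))\<^sup>2 * ((cmod (c k))\<^sup>2 * (\<Sum>i<n. (cmod (u k i))\<^sup>2)))"
    unfolding pyth norm_mult power_mult_distrib by (simp only: mult_ac)
  also have "\<dots> < (\<Sum>k\<in>K. m\<^sup>2 * ((cmod (c k))\<^sup>2 * (\<Sum>i<n. (cmod (u k i))\<^sup>2)))"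
  proof (rule sum_strict_mono_ex1[OF K])
    show "\<forall>k\<in>K. (cmod (e k))\<^sup>2 * ((cmod (c k))\<^sup>2 * (\<Sum>i<n. (cmod (u k i))\<^sup>2))
        \<le> m\<^sup>2 * ((cmod (c k))\<^sup>2 * (\<Sum>i<n. (cmod (u k i))\<^sup>2))"
      using sm pos by (intro ballI mult_right_mono mult_nonneg_nonneg) (auto intro: less_imp_le sum_nonneg)
    \<comment> \<open>Strictness comes from one index with a nonzero coefficient, as its eigenvector
      is nonzero.\<close>
    have "0 < (cmod (c k0))\<^sup>2 * (\<Sum>i<n. (cmod (u k0 i))\<^sup>2)"
      using k0 pos by (intro mult_pos_pos) auto
    then show "\<exists>k\<in>K. (cmod (e k))\<^sup>2 * ((cmod (c k))\<^sup>2 * (\<Sum>i<n. (cmod (u k i))\<^sup>2))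
        < m\<^sup>2 * ((cmod (c k))\<^sup>2 * (\<Sum>i<n. (cmod (u k i))\<^sup>2))"
      using sm k0(1) by (intro bexI[of _ k0] mult_strict_right_mono)
  qed
  also have "\<dots> = m\<^sup>2 * (\<Sum>i<n. (cmod (x i))\<^sup>2)"
    unfolding x_def pyth sum_distrib_left ..
  finally have "(\<Sum>i<n. (cmod (\<Sum>j<n. A i j * x j))\<^sup>2) < m\<^sup>2 * (\<Sum>i<n. (cmod (x i))\<^sup>2)" .
  moreover have "x j = 0" if "j \<in> J" for j
    using c(2) that by (simp add: x_def mult.commute)
  ultimately show ?thesis using that by blast
qed

text \<open>Orthogonality of the exponentials: the frequency \<open>l - k\<close> is never zero when
  \<open>\<bar>l\<bar> \<le> r < \<bar>k\<bar>\<close>.\<close>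

lemma fourier_coeff_trig_poly_outside:
  assumes f: "\<forall>\<theta>\<in>{-pi..pi}. f \<theta> = (\<Sum>k = - int r..int r. c k * exp (\<i> * of_int k * of_real \<theta>))"
    and k: "int r < \<bar>k\<bar>"
  shows "fourier_coeff f k = 0"
proof -
  have int: "integrable circle_measure (\<lambda>\<theta>. c l * exp (\<i> * of_int (l - k) * of_real \<theta>))" for l
    by (intro integrable_continuous_circle continuous_intros)
  have "(\<integral>\<theta>. f \<theta> * exp (- (\<i> * of_int k * of_real \<theta>)) \<partial>circle_measure) =
      (\<integral>\<theta>. (\<Sum>l = - int r..int r. c l * exp (\<i> * of_int (l - k) * of_real \<theta>)) \<partial>circle_measure)"
  proof (rule Bochner_Integration.integral_cong[OF refl])
    fix \<theta> assume "\<theta> \<in> space circle_measure"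
    then have "f \<theta> = (\<Sum>k = - int r..int r. c k * exp (\<i> * of_int k * of_real \<theta>))" using f by simp
    moreover have "exp (\<i> * of_int (l - k) * of_real \<theta>) = exp (\<i> * of_int l * of_real \<theta>) * exp (- (\<i> * of_int k * of_real \<theta>))" for l
      by (simp add: exp_add[symmetric] algebra_simps)
    ultimately show "f \<theta> * exp (- (\<i> * of_int k * of_real \<theta>)) = (\<Sum>l = - int r..int r. c l * exp (\<i> * of_int (l - k) * of_real \<theta>))"
      by (simp only: sum_distrib_right mult.assoc)
  qed
  also have "\<dots> = (\<Sum>l = - int r..int r. c l * (\<integral>\<theta>. exp (\<i> * of_int (l - k) * of_real \<theta>) \<partial>circle_measure))"
    by (subst Bochner_Integration.integral_sum[OF int]) (simp only: integral_mult_right_zero)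
  also have "\<dots> = 0" using k unfolding integral_exp_circle by (intro sum.neutral) auto
  finally show ?thesis by (simp add: fourier_coeff_def)
qed

text \<open>For \<open>x\<close> supported in \<open>r..n-r-1\<close>, multiplication by \<open>f\<close> is not truncated
  by the Toeplitz matrix.\<close>
lemma trig_poly_mult_trig_sum:
  assumes f: "\<forall>\<theta>\<in>{-pi..pi}. f \<theta> = (\<Sum>k = - int r..int r. fourier_coeff f k * exp (\<i> * of_int k * of_real \<theta>))"
    and x: "\<And>j. j < r \<Longrightarrow> x j = 0" "\<And>j. n - r \<le> j \<Longrightarrow> j < n \<Longrightarrow> x j = 0"
    and \<theta>: "\<theta> \<in> {-pi..pi}"
  shows "trig_sum n (\<lambda>i. \<Sum>j<n. fourier_coeff f (int i - int j) * x j) \<theta> = f \<theta> * trig_sum n x \<theta>"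
proof -
  define g where "g k = fourier_coeff f k * exp (\<i> * of_int k * of_real \<theta>)" for k
  have f\<theta>: "f \<theta> = (\<Sum>k = - int r..int r. g k)" using f \<theta> by (simp add: g_def)
  have g: "g (int i - int j) * exp (\<i> * of_nat j * of_real \<theta>)
      = fourier_coeff f (int i - int j) * exp (\<i> * of_nat i * of_real \<theta>)" for i j
    by (simp add: g_def mult.assoc exp_add[symmetric] algebra_simps)
  have shift: "(\<Sum>i<n. g (int i - int j)) * x j = f \<theta> * x j" if "j < n" for j
  proof (cases "x j = 0")
    case False
    then have j: "r \<le> j" "j < n - r" using x(1)[of j] x(2)[of j] that by (meson not_le)+
    \<comment> \<open>The differences \<open>i - j\<close> run from \<open>- j\<close> to
      \<open>n - 1 - j\<close>. This window contains \<open>- r..r\<close> because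
      \<open>r \<le> j < n - r\<close>, and the coefficients beyond \<open>- r..r\<close>
      vanish.\<close>
    have "(\<Sum>i<n. g (int i - int j)) = (\<Sum>k\<in>(\<lambda>i. int i - int j) ` {..<n}. g k)"
      by (subst sum.reindex) (auto intro: inj_onI)
    also have "\<dots> = (\<Sum>k = - int r..int r. g k)"
    proof (rule sum.mono_neutral_right)
      show "{- int r..int r} \<subseteq> (\<lambda>i. int i - int j) ` {..<n}"
      proof
        fix k assume "k \<in> {- int r..int r}"
        then show "k \<in> (\<lambda>i. int i - int j) ` {..<n}"
          using j by (intro image_eqI[of _ _ "nat (k + int j)"]) auto
      qed
      show "\<forall>k\<in>(\<lambda>i. int i - int j) ` {..<n} - {- int r..int r}. g k = 0"
        using fourier_coeff_trig_poly_outside[OF f] by (auto simp: g_def)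
    qed simp
    finally show ?thesis by (simp add: f\<theta>)
  qed simp
  have "trig_sum n (\<lambda>i. \<Sum>j<n. fourier_coeff f (int i - int j) * x j) \<theta>
      = (\<Sum>i<n. \<Sum>j<n. (fourier_coeff f (int i - int j) * exp (\<i> * of_nat i * of_real \<theta>)) * x j)"
    unfolding trig_sum_def sum_distrib_right by (simp only: mult_ac)
  also have "\<dots> = (\<Sum>j<n. \<Sum>i<n. (g (int i - int j) * exp (\<i> * of_nat j * of_real \<theta>)) * x j)"
    unfolding g by (rule sum.swap)
  also have "\<dots> = (\<Sum>j<n. ((\<Sum>i<n. g (int i - int j)) * x j) * exp (\<i> * of_nat j * of_real \<theta>))"
    unfolding sum_distrib_right by (simp only: mult_ac)
  also have "\<dots> = (\<Sum>j<n. (f \<theta> * x j) * exp (\<i> * of_nat j * of_real \<theta>))"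
    using shift by (intro sum.cong refl) simp
  also have "\<dots> = f \<theta> * trig_sum n x \<theta>"
    by (simp add: trig_sum_def sum_distrib_left mult.assoc)
  finally show ?thesis .
qed

text \<open>By Parseval both sides are integrals up to the factor \<open>2 * pi\<close>. On such
  \<open>x\<close> the Toeplitz matrix acts as multiplication by \<open>f\<close>, so the integrands
  compare pointwise.\<close>

lemma toeplitz_trig_poly_lower_bound:
  assumes f: "\<forall>\<theta>\<in>{-pi..pi}. f \<theta> = (\<Sum>k = - int r..int r. fourier_coeff f k * exp (\<i> * of_int k * of_real \<theta>))"
    and x: "\<And>j. j < r \<Longrightarrow> x j = 0" "\<And>j. n - r \<le> j \<Longrightarrow> j < n \<Longrightarrow> x j = 0"
    and m: "0 \<le> m" "\<And>\<theta>. \<theta> \<in> {-pi..pi} \<Longrightarrow> m \<le> cmod (f \<theta>)"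
  shows "m\<^sup>2 * (\<Sum>i<n. (cmod (x i))\<^sup>2) \<le> (\<Sum>i<n. (cmod (\<Sum>j<n. fourier_coeff f (int i - int j) * x j))\<^sup>2)"
proof -
  let ?Tx = "\<lambda>i. \<Sum>j<n. fourier_coeff f (int i - int j) * x j"
  have int: "integrable circle_measure (\<lambda>\<theta>. (cmod (trig_sum n v \<theta>))\<^sup>2)" for v
    by (intro integrable_continuous_circle continuous_intros continuous_trig_sum)
  have "2 * pi * (m\<^sup>2 * (\<Sum>i<n. (cmod (x i))\<^sup>2)) = (\<integral>\<theta>. m\<^sup>2 * (cmod (trig_sum n x \<theta>))\<^sup>2 \<partial>circle_measure)"
    by (simp add: trig_sum_parseval)
  also have "\<dots> \<le> (\<integral>\<theta>. (cmod (trig_sum n ?Tx \<theta>))\<^sup>2 \<partial>circle_measure)"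
  proof (rule integral_mono)
    fix \<theta> assume "\<theta> \<in> space circle_measure"
    then have \<theta>: "\<theta> \<in> {-pi..pi}" by simp
    have eq: "trig_sum n ?Tx \<theta> = f \<theta> * trig_sum n x \<theta>"
      by (rule trig_poly_mult_trig_sum[OF f _ _ \<theta>]) (use x in auto)
    have "m\<^sup>2 \<le> (cmod (f \<theta>))\<^sup>2" using m \<theta> by (intro power_mono) auto
    then show "m\<^sup>2 * (cmod (trig_sum n x \<theta>))\<^sup>2 \<le> (cmod (trig_sum n ?Tx \<theta>))\<^sup>2"
      unfolding eq norm_mult power_mult_distrib by (rule mult_right_mono) simp
  qed (use int in \<open>auto intro: integrable_mult_right\<close>)
  also have "\<dots> = 2 * pi * (\<Sum>i<n. (cmod (?Tx i))\<^sup>2)" by (rule trig_sum_parseval)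
  finally show ?thesis by (rule mult_left_le_imp_le) simp
qed

lemma eigenvalue_mset_eq:
  assumes "char_poly A = (\<Prod>e\<leftarrow>es. [:- e, 1:])"
  shows "eigenvalue_mset A = mset es"
proof -
  have "proots (\<Prod>e\<leftarrow>es. [:- e, 1:]) = mset es"
  proof (induction es)
    case (Cons e es)
    have "(\<Prod>e\<leftarrow>es. [:- e, 1:]) \<noteq> 0" by (auto simp: prod_list_zero_iff)
    then have "proots ([:- e, 1:] * (\<Prod>e\<leftarrow>es. [:- e, 1:])) = proots [:- e, 1:] + proots (\<Prod>e\<leftarrow>es. [:- e, 1:])"
      by (intro proots_mult) auto
    then show ?case using Cons.IH by (simp del: mult_pCons_left)
  qed simp
  then show ?thesis by (simp add: eigenvalue_mset_def assms)
qed

lemma norm_attains_extrema_circle: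
  fixes f :: "real \<Rightarrow> complex"
  assumes "continuous_on {-pi..pi} f"
  obtains a b where "a \<in> {-pi..pi}" "b \<in> {-pi..pi}"
    "\<And>\<theta>. \<theta> \<in> {-pi..pi} \<Longrightarrow> cmod (f a) \<le> cmod (f \<theta>)"
    "\<And>\<theta>. \<theta> \<in> {-pi..pi} \<Longrightarrow> cmod (f \<theta>) \<le> cmod (f b)"
proof -
  have c: "continuous_on {-pi..pi} (\<lambda>\<theta>. cmod (f \<theta>))" using assms by (rule continuous_on_norm)
  have ne: "{-pi..pi} \<noteq> {}" by simp
  from continuous_attains_inf[OF compact_Icc ne c] continuous_attains_sup[OF compact_Icc ne c]
  show ?thesis using that by blast
qed

subsection \<open>Localization of the spectrum\<close>

lemma flipped_eigenvalue_real:
  assumes real: "\<And>k. fourier_coeff f k \<in> \<real>"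
    and ev: "\<And>i. i < n \<Longrightarrow> (\<Sum>j<n. fourier_coeff f (int n - 1 - int i - int j) * x j) = z * x i"
    and nz: "\<exists>i<n. x i \<noteq> 0"
  shows "z = complex_of_real (Re z)"
proof -
  have "z \<in> \<real>"
  proof (rule hermitian_eigenvalue_real[OF _ ev nz])
    fix i j
    have "int n - 1 - int j - int i = int n - 1 - int i - int j" by simp
    then show "fourier_coeff f (int n - 1 - int j - int i) = cnj (fourier_coeff f (int n - 1 - int i - int j))"
      using real by (simp only: Reals_cnj_iff)
  qed
  then show ?thesis by (simp only: of_real_Re)
qed

text \<open>A finite essential supremum is an almost-everywhere bound of \<open>|f|\<close>, to
  which the real estimates apply; an infinite one leaves nothing to show.\<close>

lemma (in flipped_eigenvector) norm_le_ess_sup: "ereal (cmod z) \<le> ess_sup (\<lambda>\<theta>. cmod (f \<theta>))"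
  and norm_less_ess_sup: "\<not> (\<exists>c. AE \<theta> in circle_measure. cmod (f \<theta>) = c) \<Longrightarrow>
    ereal (cmod z) < ess_sup (\<lambda>\<theta>. cmod (f \<theta>))"
proof -
  have AE: "AE \<theta> in circle_measure. ereal (cmod (f \<theta>)) \<le> ess_sup (\<lambda>\<theta>. cmod (f \<theta>))"
    by (intro AE_le_ess_sup borel_measurable_integrable integrable_norm f)
  show "ereal (cmod z) \<le> ess_sup (\<lambda>\<theta>. cmod (f \<theta>))"
  proof (cases "ess_sup (\<lambda>\<theta>. cmod (f \<theta>))")
    case (real C)
    then show ?thesis using norm_le[of C] AE by simp
  next
    \<comment> \<open>Some point would satisfy \<open>|f| \<le> - \<infinity>\<close>, which is
      absurd.\<close>
    case MInf
    then show ?thesis using AE_circle_measure_ex[OF AE] by simp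
  qed simp
  assume nc: "\<not> (\<exists>c. AE \<theta> in circle_measure. cmod (f \<theta>) = c)"
  show "ereal (cmod z) < ess_sup (\<lambda>\<theta>. cmod (f \<theta>))"
  proof (cases "ess_sup (\<lambda>\<theta>. cmod (f \<theta>))")
    case (real C)
    then show ?thesis using norm_less[of C] AE nc by simp
  next
    case MInf
    then show ?thesis using AE_circle_measure_ex[OF AE] by simp
  qed simp
qed

text \<open>With more than \<open>2 * r\<close> eigenvectors, the first and last \<open>r\<close>
  entries can be made to vanish. The resulting \<open>x\<close> has an image too short for the lower
  bound on the Toeplitz matrix.\<close>

lemma card_small_eigenvalues_le:
  assumes f: "\<forall>\<theta>\<in>{-pi..pi}. f \<theta> = (\<Sum>k = - int r..int r. fourier_coeff f k * exp (\<i> * of_int k * of_real \<theta>))"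
    and m: "0 \<le> m" "\<And>\<theta>. \<theta> \<in> {-pi..pi} \<Longrightarrow> m \<le> cmod (f \<theta>)"
    and ev: "\<And>k i. k \<in> K \<Longrightarrow> i < n \<Longrightarrow>
      (\<Sum>j<n. fourier_coeff f (int n - 1 - int i - int j) * u k j) = e k * u k i"
    and nz: "\<And>k. k \<in> K \<Longrightarrow> \<exists>i<n. u k i \<noteq> 0"
    and orth: "\<And>k l. k \<in> K \<Longrightarrow> l \<in> K \<Longrightarrow> k \<noteq> l \<Longrightarrow> (\<Sum>i<n. cnj (u k i) * u l i) = 0"
    and K: "finite K" and small: "\<And>k. k \<in> K \<Longrightarrow> cmod (e k) < m"
  shows "card K \<le> 2 * r"
proof (rule ccontr)
  assume "\<not> ?thesis"
  \<comment> \<open>The two blocks of indices may overlap when \<open>n\<close> is small, hence only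
    an inequality.\<close>
  moreover have "card ({..<r} \<union> {n - r..<n}) \<le> card {..<r} + card {n - r..<n}" by (rule card_Un_le)
  ultimately have card: "card ({..<r} \<union> {n - r..<n}) < card K" by simp
  obtain x where x: "\<And>j. j \<in> {..<r} \<union> {n - r..<n} \<Longrightarrow> x j = 0"
    and lt: "(\<Sum>i<n. (cmod (\<Sum>j<n. fourier_coeff f (int n - 1 - int i - int j) * x j))\<^sup>2)
      < m\<^sup>2 * (\<Sum>i<n. (cmod (x i))\<^sup>2)"
    by (rule ex_small_image_vanishing_on[where A = "\<lambda>i j. fourier_coeff f (int n - 1 - int i - int j)"
          and u = u and e = e, OF K _ card ev nz orth small]) auto
  note lt
  also have "m\<^sup>2 * (\<Sum>i<n. (cmod (x i))\<^sup>2) \<le> (\<Sum>i<n. (cmod (\<Sum>j<n. fourier_coeff f (int i - int j) * x j))\<^sup>2)"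
    by (rule toeplitz_trig_poly_lower_bound[OF f _ _ m]) (use x in auto)
  also have "\<dots> = (\<Sum>i<n. (cmod (\<Sum>j<n. fourier_coeff f (int n - 1 - int (n - Suc i) - int j) * x j))\<^sup>2)"
    by (intro sum.cong refl) (simp only: hankel_sum_eq_toeplitz_sum lessThan_iff)
  \<comment> \<open>Reversing the order of the rows does not change the sum of squares.\<close>
  also have "\<dots> = (\<Sum>i<n. (cmod (\<Sum>j<n. fourier_coeff f (int n - 1 - int i - int j) * x j))\<^sup>2)"
    by (rule sum.nat_diff_reindex)
  finally show False by simp
qed

lemma flipped_toeplitz_trig_poly_outliers:
  fixes n :: nat
  assumes int: "integrable circle_measure f" and real: "\<And>k. fourier_coeff f k \<in> \<real>"
    and f: "\<forall>\<theta>\<in>{-pi..pi}. f \<theta> = (\<Sum>k = - int r..int r. fourier_coeff f k * exp (\<i> * of_int k * of_real \<theta>))"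
    and m: "0 \<le> m" "\<And>\<theta>. \<theta> \<in> {-pi..pi} \<Longrightarrow> m \<le> cmod (f \<theta>)"
    and C: "\<And>\<theta>. \<theta> \<in> {-pi..pi} \<Longrightarrow> cmod (f \<theta>) \<le> C"
  defines "outliers \<equiv> filter_mset (\<lambda>z. z \<notin> complex_of_real ` ({- C..- m} \<union> {m..C}))
    (eigenvalue_mset (flipped_toeplitz n f))"
  shows "size outliers \<le> 2 * r" "set_mset outliers \<subseteq> complex_of_real ` {- m<..<m}"
proof -
  define A where "A = (\<lambda>i j. fourier_coeff f (int n - 1 - int i - int j))"
  have herm: "A j i = cnj (A i j)" for i j
  proof -
    have "int n - 1 - int j - int i = int n - 1 - int i - int j" by simp
    then show ?thesis using real by (simp only: A_def Reals_cnj_iff)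
  qed
  obtain es u where es: "char_poly (Matrix.mat n n (\<lambda>(i, j). A i j)) = (\<Prod>e\<leftarrow>es. [:- e, 1:])" "length es = n"
    and ev: "\<And>k i. k < n \<Longrightarrow> i < n \<Longrightarrow> (\<Sum>j<n. A i j * u k j) = es ! k * u k i"
    and nz: "\<And>k. k < n \<Longrightarrow> \<exists>i<n. u k i \<noteq> 0"
    and orth: "\<And>k l. k < n \<Longrightarrow> l < n \<Longrightarrow> k \<noteq> l \<Longrightarrow> (\<Sum>i<n. cnj (u k i) * u l i) = 0"
    by (rule hermitian_orthogonal_eigenvectors[of n A, OF herm]) blast
  let ?P = "\<lambda>z. z \<notin> complex_of_real ` ({- C..- m} \<union> {m..C})"
  have out: "outliers = filter_mset ?P (mset es)"
    using eigenvalue_mset_eq[OF es(1)] by (simp only: outliers_def flipped_toeplitz_eq A_def)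
  have es_real: "es ! k = complex_of_real (Re (es ! k))" if "k < n" for k
    using flipped_eigenvalue_real[OF real ev[OF that, unfolded A_def] nz[OF that]] .
  \<comment> \<open>Every eigenvalue is real with modulus at most \<open>C\<close>, so it can miss
    both intervals only by having modulus below \<open>m\<close>.\<close>
  have small: "cmod (es ! k) < m" if k: "k < n" and P: "?P (es ! k)" for k
  proof (rule ccontr)
    assume "\<not> ?thesis"
    moreover have "flipped_eigenvector f n (u k) (es ! k)"
      by (rule flipped_eigenvectorI[OF int nz[OF k]]) (use ev[OF k] in \<open>simp add: A_def\<close>)
    then have "cmod (es ! k) \<le> C"
      by (rule flipped_eigenvector.norm_le) (use C in \<open>intro AE_I2, simp\<close>)
    moreover have "cmod (es ! k) = \<bar>Re (es ! k)\<bar>"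
      using es_real[OF k] by (metis norm_of_real)
    ultimately have "Re (es ! k) \<in> {- C..- m} \<union> {m..C}" by auto
    then show False using P es_real[OF k] by (metis imageI)
  qed
  \<comment> \<open>Multiplicities become distinct indices into \<open>es\<close>, each with its own
    orthogonal eigenvector.\<close>
  have "size outliers = card {k. k < n \<and> ?P (es ! k)}"
    unfolding out by (simp only: size_mset mset_filter[symmetric] length_filter_conv_card es(2))
  also have "\<dots> \<le> 2 * r"
    by (rule card_small_eigenvalues_le[OF f m, where u = u and e = "\<lambda>k. es ! k" and n = n])
      (use ev nz orth small in \<open>auto simp: A_def\<close>)
  finally show "size outliers \<le> 2 * r" .
  show "set_mset outliers \<subseteq> complex_of_real ` {- m<..<m}"
  proof
    fix z assume "z \<in># outliers"
    then obtain k where k: "k < n" "z = es ! k" "?P (es ! k)"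
      unfolding out by (auto simp only: set_mset_filter mem_Collect_eq set_mset_mset in_set_conv_nth es(2))
    have "\<bar>Re (es ! k)\<bar> < m" using small[OF k(1,3)] es_real[OF k(1)] by (metis norm_of_real)
    then have "Re (es ! k) \<in> {- m<..<m}" by auto
    then show "z \<in> complex_of_real ` {- m<..<m}" using es_real[OF k(1)] k(2) by (metis imageI)
  qed
qed

theorem theorem3p5:
  fixes f :: "real \<Rightarrow> complex" and n :: nat
  assumes "integrable circle_measure f"
    and "\<And>k. fourier_coeff f k \<in> \<real>"
  defines "d \<equiv> infdist 0 (convex hull (essential_range f))"
    and "M \<equiv> ess_sup (\<lambda>\<theta>. cmod (f \<theta>))"
  shows
    "(\<forall>z. eigenvalue (flipped_toeplitz n f) z \<longrightarrow>
        z \<in> complex_of_real ` {x. ereal x \<in> {- M..- ereal d} \<union> {ereal d..M}})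
     \<and> (\<not> (\<exists>c. AE \<theta> in circle_measure. cmod (f \<theta>) = c) \<longrightarrow>
        (\<forall>z. eigenvalue (flipped_toeplitz n f) z \<longrightarrow>
          z \<in> complex_of_real ` {x. ereal x \<in> {- M<..- ereal d} \<union> {ereal d..<M}}))
     \<and> (\<forall>r::nat.
        (\<forall>\<theta>\<in>{-pi..pi}. f \<theta> =
           (\<Sum>k = - int r..int r. fourier_coeff f k * exp (\<i> * of_int k * of_real \<theta>))) \<longrightarrow>
        (let m' = (LEAST y. y \<in> (\<lambda>\<theta>. cmod (f \<theta>)) ` {-pi..pi});
             M' = (GREATEST y. y \<in> (\<lambda>\<theta>. cmod (f \<theta>)) ` {-pi..pi});
             outliers = filter_mset (\<lambda>z. z \<notin> complex_of_real ` ({- M'..- m'} \<union> {m'..M'}))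
                          (eigenvalue_mset (flipped_toeplitz n f))
         in size outliers \<le> 2 * r \<and> set_mset outliers \<subseteq> complex_of_real ` {- m'<..<m'}))"
proof (intro conjI allI impI)
  \<comment> \<open>The first two items share these estimates; the sign of \<open>Re z\<close> then
    selects the interval.\<close>
  have bounds: "z = complex_of_real (Re z)" "ereal d \<le> ereal \<bar>Re z\<bar>" "ereal \<bar>Re z\<bar> \<le> M"
    "\<not> (\<exists>c. AE \<theta> in circle_measure. cmod (f \<theta>) = c) \<Longrightarrow> ereal \<bar>Re z\<bar> < M"
    if z: "eigenvalue (flipped_toeplitz n f) z" for z
  proof -
    obtain x where x: "\<exists>i<n. x i \<noteq> 0"
      "\<And>i. i < n \<Longrightarrow> (\<Sum>j<n. fourier_coeff f (int n - 1 - int i - int j) * x j) = z * x i"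
      by (rule flipped_toeplitz_eigenvalueE[OF z]) blast
    interpret flipped_eigenvector f n x z
      by (rule flipped_eigenvectorI[OF assms(1) x])
    show real: "z = complex_of_real (Re z)"
      by (rule flipped_eigenvalue_real[OF assms(2) x(2) x(1)])
    then have "cmod z = \<bar>Re z\<bar>" by (metis norm_of_real)
    then show "ereal d \<le> ereal \<bar>Re z\<bar>" "ereal \<bar>Re z\<bar> \<le> M"
      "\<not> (\<exists>c. AE \<theta> in circle_measure. cmod (f \<theta>) = c) \<Longrightarrow> ereal \<bar>Re z\<bar> < M"
      using norm_ge norm_le_ess_sup norm_less_ess_sup by (simp_all add: d_def M_def)
  qed
  fix z assume z: "eigenvalue (flipped_toeplitz n f) z"
  have "ereal (Re z) \<in> {- M..- ereal d} \<union> {ereal d..M}"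
  proof (cases "0 \<le> Re z")
    case True
    then show ?thesis using bounds[OF z] by simp
  next
    case False
    \<comment> \<open>The sign is moved in the extended reals, since \<open>M\<close> may be
      infinite.\<close>
    then have "- ereal (Re z) \<le> M" using bounds[OF z] by simp
    then have "- M \<le> ereal (Re z)" by (simp only: ereal_uminus_le_reorder)
    then show ?thesis using bounds[OF z] False by simp
  qed
  then show "z \<in> complex_of_real ` {x. ereal x \<in> {- M..- ereal d} \<union> {ereal d..M}}"
    by (intro image_eqI[where x = "Re z"] CollectI) (rule bounds(1)[OF z])
  assume nc: "\<not> (\<exists>c. AE \<theta> in circle_measure. cmod (f \<theta>) = c)"
  have "ereal (Re z) \<in> {- M<..- ereal d} \<union> {ereal d..<M}"
  proof (cases "0 \<le> Re z")
    case True
    then show ?thesis using bounds(2,4)[OF z] nc by simp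
  next
    case False
    then have "- ereal (Re z) < M" using bounds(4)[OF z nc] by simp
    then have "- M < ereal (Re z)" by (simp only: ereal_uminus_less_reorder)
    then show ?thesis using bounds(2)[OF z] False by simp
  qed
  then show "z \<in> complex_of_real ` {x. ereal x \<in> {- M<..- ereal d} \<union> {ereal d..<M}}"
    by (intro image_eqI[where x = "Re z"] CollectI) (rule bounds(1)[OF z])
next
  fix r :: nat
  assume f: "\<forall>\<theta>\<in>{-pi..pi}. f \<theta> =
    (\<Sum>k = - int r..int r. fourier_coeff f k * exp (\<i> * of_int k * of_real \<theta>))"
  \<comment> \<open>\<open>LEAST\<close> and \<open>GREATEST\<close> are meaningful because
    continuity on a compact interval makes \<open>|f|\<close> attain its extrema.\<close>
  have "continuous_on {-pi..pi} (\<lambda>\<theta>. \<Sum>k = - int r..int r. fourier_coeff f k * exp (\<i> * of_int k * of_real \<theta>))"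
    by (intro continuous_intros)
  then have "continuous_on {-pi..pi} f"
    by (rule continuous_on_eq) (use f in simp)
  then obtain a b where ab: "a \<in> {-pi..pi}" "b \<in> {-pi..pi}"
    and a: "\<And>\<theta>. \<theta> \<in> {-pi..pi} \<Longrightarrow> cmod (f a) \<le> cmod (f \<theta>)"
    and b: "\<And>\<theta>. \<theta> \<in> {-pi..pi} \<Longrightarrow> cmod (f \<theta>) \<le> cmod (f b)"
    by (rule norm_attains_extrema_circle) blast
  have m': "(LEAST y. y \<in> (\<lambda>\<theta>. cmod (f \<theta>)) ` {-pi..pi}) = cmod (f a)"
    by (rule Least_equality) (use a ab in blast)+
  have M': "(GREATEST y. y \<in> (\<lambda>\<theta>. cmod (f \<theta>)) ` {-pi..pi}) = cmod (f b)"
    by (rule Greatest_equality) (use b ab in blast)+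
  show "let m' = (LEAST y. y \<in> (\<lambda>\<theta>. cmod (f \<theta>)) ` {-pi..pi});
             M' = (GREATEST y. y \<in> (\<lambda>\<theta>. cmod (f \<theta>)) ` {-pi..pi});
             outliers = filter_mset (\<lambda>z. z \<notin> complex_of_real ` ({- M'..- m'} \<union> {m'..M'}))
                          (eigenvalue_mset (flipped_toeplitz n f))
         in size outliers \<le> 2 * r \<and> set_mset outliers \<subseteq> complex_of_real ` {- m'<..<m'}"
    unfolding m' M' Let_def
    using flipped_toeplitz_trig_poly_outliers[OF assms(1,2) f norm_ge_zero a b] by blast
qed

end
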